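(* The following identities hold: \[ \sup_{N\in\mathbb{N}}G(\eta(N);s)=\frac{1}{2^{s}-1}\quad (0<s<1),\qquad \inf_{N\in\mathbb{N}}G(\eta(N);s)=\frac{1}{2^{s}-1}\quad (s>1),\qquad \inf_{N\in\mathbb{N}}\Lambda(\eta(N))=-2\log 2 . \] Consequently, for every greedy $s$-energy sequence $(a_n)_{n=0}^\infty$ on $S^1$, with associated sequence $(F_{N,s})_{N\ge 1}$, \[ \liminf_{N\to\infty}F_{N,s}=\begin{cases}\dfrac{2\zeta(s)}{(2\pi)^{s}}, & s>0,\ s\neq 1,\\[0.8em] \dfrac{1}{\pi}\left(\gamma+\log(2/\pi)\right), & s=1.\end{cases} \]
   Context: $\mathbb{N}=\{1,2,3,\ldots\}$. Write $N\in\mathbb{N}$ in binary as $N=2^{n_1}+2^{n_2}+\cdots+2^{n_p}$ with integers $n_1>n_2>\cdots>n_p\ge 0$, and set $\eta(N):=\left(\frac{2^{n_1}}{N},\ldots,\frac{2^{n_p}}{N}\right)$. For a vector $\vec\theta=(\theta_1,\ldots,\theta_p)$ with positive components, $G(\vec\theta;s):=\sum_{k=1}^p\theta_k^s$ and $\Lambda(\vec\theta):=\sum_{k=1}^p\theta_k\log\theta_k$. $S^1$ is the unit circle in $\mathbb{C}$. For $s>0$ let $K_s(x,y):=|x-y|^{-s}$ (with value $+\infty$ if $x=y$). A greedy $s$-energy sequence is a sequence $(a_n)_{n=0}^\infty\subset S^1$ with $a_0\in S^1$ arbitrary and, for each $n\ge1$, $a_n$ any point satisfying $\sum_{\ell=0}^{n-1}K_s(a_n,a_\ell)=\min_{x\in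 S^1}\sum_{\ell=0}^{n-1}K_s(x,a_\ell)$. Put $U_{N,s}(x):=\sum_{k=0}^{N-1}K_s(x,a_k)$, and \[ F_{N,s}:=\begin{cases}\dfrac{U_{N,s}(a_N)-N I_s(\sigma)}{N^s}, & 0<s<1,\\[0.6em] \dfrac{U_{N,1}(a_N)-\pi^{-1}N\log N}{N}, & s=1,\\[0.6em] \dfrac{U_{N,s}(a_N)}{N^s}, & s>1,\end{cases} \] where, for $0<s<1$, $I_s(\sigma)=\iint_{S^1\times S^1}|x-y|^{-s}\,d\sigma(x)\,d\sigma(y)=\frac{2^{-s}}{\sqrt\pi}\frac{\Gamma(\frac{1-s}{2})}{\Gamma(1-\frac s2)}$ and $\sigma$ is the arclength measure on $S^1$ normalized to have total mass $1$. $\zeta$ is the Riemann zeta function (analytically continued) and $\gamma$ is the Euler–Mascheroni constant. *)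

theory Defs
  imports "HOL-Complex_Analysis.Complex_Analysis" "HOL-Library.Nat_Bijection"
begin

section \<open>Binary expansions\<close>

definition binary_exponents :: "nat \<Rightarrow> nat list" where
  "binary_exponents N = rev (sorted_list_of_set {n. bit N n})"

lemma binary_exponents_iff:
  "ns = binary_exponents N \<longleftrightarrow> sorted_wrt (>) ns \<and> N = (\<Sum>n\<leftarrow>ns. 2 ^ n)"
proof -
  have bits: "{n. bit M n} = set_decode M" for M :: nat
    by (auto simp: set_decode_def bit_iff_odd)
  have sum: "(\<Sum>n\<leftarrow>ms. 2 ^ n) = set_encode (set ms)" if "sorted_wrt (>) ms" for ms :: "nat list"
  proof -
    have "distinct ms"
      using that by (induction ms) auto
    then show ?thesis
      by (simp add: set_encode_def sum_list_distinct_conv_sum_set)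
  qed
  have sorted: "sorted_wrt (>) (binary_exponents N)"
    by (simp add: binary_exponents_def sorted_wrt_rev)
  have set: "set (binary_exponents N) = set_decode N"
    by (simp add: binary_exponents_def bits)
  show ?thesis
  proof (intro iffI conjI; (elim conjE)?)
    assume "ns = binary_exponents N"
    then show "sorted_wrt (>) ns" "N = (\<Sum>n\<leftarrow>ns. 2 ^ n)"
      using sorted sum[OF sorted] set by auto
  next
    assume ns: "sorted_wrt (>) ns" "N = (\<Sum>n\<leftarrow>ns. 2 ^ n)"
    then have "set ns = set_decode N"
      using sum[OF ns(1)] by simp
    moreover have "sorted_wrt (<) (rev ns)"
      using ns(1) by (simp add: sorted_wrt_rev)
    ultimately have "rev ns = sorted_list_of_set (set_decode N)"
      by (metis set_rev sorted_list_of_set.idem_if_sorted_distinct strict_sorted_iff)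
    then show "ns = binary_exponents N"
      by (metis binary_exponents_def bits rev_rev_ident)
  qed
qed

definition eta :: "nat \<Rightarrow> real list" where
  "eta N = map (\<lambda>n. 2 ^ n / real N) (binary_exponents N)"

definition G :: "real list \<Rightarrow> real \<Rightarrow> real" where
  "G \<theta> s = (\<Sum>t\<leftarrow>\<theta>. t powr s)"

definition Lambda :: "real list \<Rightarrow> real" where
  "Lambda \<theta> = (\<Sum>t\<leftarrow>\<theta>. t * ln t)"


section \<open>Greedy energy sequences on the unit circle\<close>

abbreviation unit_circle :: "complex set" where
  "unit_circle \<equiv> sphere 0 1"

definition riesz_kernel :: "real \<Rightarrow> complex \<Rightarrow> complex \<Rightarrow> ennreal" where
  "riesz_kernel s x y = (if x = y then \<infinity> else ennreal (norm (x - y) powr (- s)))"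

definition potential :: "(nat \<Rightarrow> complex) \<Rightarrow> real \<Rightarrow> nat \<Rightarrow> complex \<Rightarrow> ennreal" where
  "potential a s N x = (\<Sum>k<N. riesz_kernel s x (a k))"

definition greedy_sequence :: "real \<Rightarrow> (nat \<Rightarrow> complex) \<Rightarrow> bool" where
  "greedy_sequence s a \<longleftrightarrow>
     a 0 \<in> unit_circle \<and>
     (\<forall>n\<ge>1. a n \<in> unit_circle \<and> (\<forall>x\<in>unit_circle. potential a s n (a n) \<le> potential a s n x))"

text \<open>Normalized arclength measure on the unit circle, as a Borel measure on the complex plane.\<close>
definition arclength :: "complex measure" where
  "arclength = distr (uniform_measure lborel {0..2 * pi}) borel cis"

definition circle_energy :: "real \<Rightarrow> ennreal" where
  "circle_energy s = (\<integral>\<^sup>+ y. (\<integral>\<^sup>+ x. riesz_kernel s x y \<partial>arclength) \<partial>arclength)"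

text \<open>The values are taken in the extended reals because the potential may a priori be infinite.\<close>
definition F :: "(nat \<Rightarrow> complex) \<Rightarrow> real \<Rightarrow> nat \<Rightarrow> ereal" where
  "F a s N =
     (if s < 1 then
        (enn2ereal (potential a s N (a N)) - ereal (real N) * enn2ereal (circle_energy s))
          / ereal (real N powr s)
      else if s = 1 then
        (enn2ereal (potential a 1 N (a N)) - ereal (real N * ln (real N) / pi)) / ereal (real N)
      else enn2ereal (potential a s N (a N)) / ereal (real N powr s))"


section \<open>The Riemann zeta function\<close>

text \<open>The holomorphic continuation of the Dirichlet series to the plane without the point \<open>1\<close>.
  It is unique there by the identity theorem; the value at \<open>1\<close> is unspecified.\<close>
definition zeta :: "complex \<Rightarrow> complex" where
  "zeta = (SOME f. f holomorphic_on (- {1}) \<and>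
     (\<forall>s. Re s > 1 \<longrightarrow> (\<lambda>n. 1 / of_nat (Suc n) powr s) sums f s))"

end

theory Submission
  imports Defs "HOL-Real_Asymp.Real_Asymp"
begin

text \<open>
  The extremal values of \<open>G\<close> and \<open>\<Lambda>\<close> are found by induction on the highest binary digit of \<open>N\<close>. For
  \<open>N = 2\<^sup>n + M\<close> the bound for \<open>N\<close> follows from that for \<open>M\<close> because \<open>(1 + x)\<^sup>s - x\<^sup>s\<close>, with \<open>x = M / 2\<^sup>n < 1\<close>,
  compares in the right direction with its value \<open>2\<^sup>s - 1\<close> at \<open>x = 1\<close>; for \<open>\<Lambda>\<close> the same is done with
  \<open>(1 + x) ln (1 + x) - x ln x\<close> and its value \<open>2 ln 2\<close>. The numbers \<open>N = 2\<^sup>k - 1\<close> approach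
  the bounds, as \<open>\<eta>(N)\<close> then tends to \<open>(1/2, 1/4, 1/8, \<dots>)\<close>.

  The same recursion governs greedy sequences. By convexity of the kernel, the potential of the
  \<open>m\<close>-th roots of a unimodular number \<open>c\<close> is minimal exactly at the \<open>m\<close>-th roots of \<open>- c\<close>, the middles of the
  arcs between them (\<open>root_potential_midpoint\<close>, \<open>root_potential_gt\<close>). Hence, for \<open>m = 2\<^sup>n\<close>, the first \<open>m\<close>
  points of a greedy sequence are the \<open>m\<close>-th roots of a number \<open>c\<close>, and the next \<open>m\<close> points are the
  \<open>m\<close>-th roots of \<open>- c\<close>, in an order that is again greedy (\<open>greedy_structure\<close>). Consequently
  the potential at the new point \<open>a N\<close> is the sum, over the binary digits \<open>m\<close> of \<open>N\<close>, of the potential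
  \<open>mid_sum s m\<close> of \<open>m\<close> equally spaced points at the middle of an arc (\<open>greedy_potential\<close>).

  Put \<open>c = 2 \<zeta>(s) / (2 \<pi>)\<^sup>s\<close>. The midpoint sums satisfy \<open>mid_sum s m = m I + (2\<^sup>s - 1) c m\<^sup>s + o(m\<^sup>s)\<close>
  for even \<open>m\<close>, where \<open>I\<close> is the energy of the circle if \<open>s < 1\<close> and \<open>0\<close> if \<open>s > 1\<close>. To see this for \<open>s < 1\<close>,
  one replaces chords by arcs. The difference of the two kernels is monotone on a half circle, so its
  sum over the midpoints differs from \<open>m\<close> times a constant by \<open>O(1)\<close>, and the arcs lead to
  \<open>\<Sum>j<m/2. (2 j + 1) powr (- s)\<close>, whose constant term is \<open>(1 - 2 powr (- s)) \<zeta>(s)\<close>. Summation over the digits yields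
  \<open>F = (2\<^sup>s - 1) c G(\<eta>(N); s) + o(1)\<close>. As \<open>\<zeta>\<close> is at most \<open>0\<close> on \<open>(0, 1)\<close> and at least \<open>0\<close> beyond \<open>1\<close>, the lower
  limit is \<open>c\<close> in both cases. For \<open>s = 1\<close> the expansion contains \<open>m ln m / \<pi>\<close>, and \<open>\<Lambda>\<close> takes the place of \<open>G\<close>.

  The zeta function is an arbitrary holomorphic continuation, so its existence on the whole punctured
  plane has to be established as well. It is built on successive half-planes: summing the Taylor
  expansion of \<open>(n + 1) powr (1 - s) - n powr (1 - s)\<close> over \<open>n\<close> expresses \<open>(s - 1) \<zeta>(s)\<close> through values further to the
  right (\<open>zeta_continuation_step\<close>). The crudest form of this expansion also identifies \<open>\<zeta>\<close> on \<open>(0, 1)\<close> as a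
  limit of partial sums.
\<close>

section \<open>Sums over binary digits\<close>

definition bit_sum :: "(nat \<Rightarrow> real) \<Rightarrow> nat \<Rightarrow> real" where
  "bit_sum f N = (\<Sum>n\<in>set_decode N. f n)"

text \<open>
  Splitting off the highest binary digit. This is the recursion that the binary expansion of \<open>N\<close> and
  the greedy sequences have in common: of the first \<open>2\<^sup>n + M\<close> points, the first \<open>2\<^sup>n\<close> form a complete
  set of roots, and the other \<open>M\<close> points start the construction again.
\<close>

lemma binary_induct [case_names zero top_bit]:
  assumes "P 0" and "\<And>n M. M < 2 ^ n \<Longrightarrow> P M \<Longrightarrow> P (2 ^ n + M)"
  shows "P (N::nat)"
proof (induction N rule: less_induct)
  case (less N)
  show ?case
  proof (cases "N = 0")
    case False
    then obtain n where n: "2 ^ n \<le> N" "N < 2 ^ Suc n"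
      using ex_power_ivl1[of 2 N] by auto
    have "P (2 ^ n + (N - 2 ^ n))"
      using n by (intro assms(2) less) auto
    with n show ?thesis by simp
  qed (use assms in simp)
qed

lemma set_decode_top_bit:
  assumes "M < 2 ^ n"
  shows "n \<notin> set_decode M" "set_decode (2 ^ n + M) = insert n (set_decode M)"
proof -
  show "n \<notin> set_decode M" using assms by (simp add: set_decode_def)
  then show "set_decode (2 ^ n + M) = insert n (set_decode M)"
    by (rule set_decode_plus_power_2)
qed

lemma bit_sum_0 [simp]: "bit_sum f 0 = 0"
  by (simp add: bit_sum_def)

lemma bit_sum_top_bit: "M < 2 ^ n \<Longrightarrow> bit_sum f (2 ^ n + M) = f n + bit_sum f M"
  using set_decode_top_bit[of M n] by (simp add: bit_sum_def)

lemma bit_sum_power_2: "bit_sum (\<lambda>n. 2 ^ n) N = real N"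
  by (induction N rule: binary_induct) (auto simp: bit_sum_top_bit)

lemma bit_sum_add: "bit_sum (\<lambda>n. f n + g n) N = bit_sum f N + bit_sum g N"
  by (simp add: bit_sum_def sum.distrib)

lemma bit_sum_cmult: "bit_sum (\<lambda>n. c * f n) N = c * bit_sum f N"
  by (simp add: bit_sum_def sum_distrib_left)

lemma bit_sum_mono: "(\<And>n. f n \<le> g n) \<Longrightarrow> bit_sum f N \<le> bit_sum g N"
  by (simp add: bit_sum_def sum_mono)

lemma bit_sum_nonneg: "(\<And>n. 0 \<le> f n) \<Longrightarrow> 0 \<le> bit_sum f N"
  by (simp add: bit_sum_def sum_nonneg)

lemma bit_set_eq_set_decode: "{n. bit N n} = set_decode N" for N :: nat
  by (auto simp: set_decode_def bit_iff_odd)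

lemma set_binary_exponents: "set (binary_exponents N) = set_decode N"
  by (simp add: binary_exponents_def bit_set_eq_set_decode)

lemma sum_list_binary_exponents: "(\<Sum>n\<leftarrow>binary_exponents N. f n) = bit_sum f N"
  by (simp add: bit_sum_def binary_exponents_def bit_set_eq_set_decode sum_list_distinct_conv_sum_set)

text \<open>
  The numbers with all binary digits equal to \<open>1\<close> are those along which the extremal values of \<open>G\<close> and
  \<open>\<Lambda>\<close> are approached.
\<close>

lemma bit_sum_repunit: "bit_sum f (2 ^ k - 1) = (\<Sum>n<k. f n)"
proof -
  have "set_encode {..<k} = 2 ^ k - 1"
    unfolding set_encode_def using sum_power2[of k] by (simp add: atLeast0LessThan)
  then have "set_decode (2 ^ k - 1) = {..<k}"
    by (metis finite_lessThan set_encode_inverse)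
  then show ?thesis by (simp add: bit_sum_def)
qed

lemma power_2_powr: "(2 ^ n) powr s = 2 powr (real n * s)" for s :: real
  by (metis powr_powr powr_realpow zero_less_numeral)

section \<open>The extremal values of \<open>G\<close> and \<open>\<Lambda>\<close>\<close>

lemma two_powr_gt_1: "s > 0 \<Longrightarrow> 1 < (2::real) powr s"
  using powr_less_mono[of 0 s 2] by simp

lemma G_eta:
  assumes "N > 0"
  shows "G (eta N) s = bit_sum (\<lambda>n. 2 powr (real n * s)) N / real N powr s"
proof -
  have "G (eta N) s = bit_sum (\<lambda>n. (2 ^ n / real N) powr s) N"
    by (simp add: G_def eta_def comp_def sum_list_binary_exponents)
  also have "\<dots> = bit_sum (\<lambda>n. 2 powr (real n * s)) N / real N powr s"
    by (simp add: bit_sum_def sum_divide_distrib powr_divide power_2_powr)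
  finally show ?thesis .
qed

lemma Lambda_eta:
  assumes "N > 0"
  shows "Lambda (eta N) = bit_sum (\<lambda>n. 2 ^ n * (real n * ln 2)) N / real N - ln (real N)"
proof -
  have "Lambda (eta N) = bit_sum (\<lambda>n. 2 ^ n / real N * ln (2 ^ n / real N)) N"
    by (simp add: Lambda_def eta_def comp_def sum_list_binary_exponents)
  also have "\<dots> = bit_sum (\<lambda>n. inverse (real N) * (2 ^ n * (real n * ln 2)) + - (ln N / N) * 2 ^ n) N"
    using assms by (simp add: bit_sum_def ln_div ln_realpow field_simps)
  also have "\<dots> = bit_sum (\<lambda>n. 2 ^ n * (real n * ln 2)) N / real N - ln (real N)"
    unfolding bit_sum_add bit_sum_cmult bit_sum_power_2 using assms by (simp add: field_simps)
  finally show ?thesis .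
qed

text \<open>
  Up to scaling by \<open>a\<close> this compares \<open>(1 + x)\<^sup>s - x\<^sup>s\<close> at \<open>x = b / a \<le> 1\<close> with its value \<open>2\<^sup>s - 1\<close> at \<open>1\<close>:
  for \<open>s \<le> 1\<close> the difference is nonincreasing in \<open>x\<close>, since \<open>x powr (s - 1)\<close> is. With \<open>a = 2\<^sup>n\<close> and \<open>b = M < 2\<^sup>n\<close> it is
  the step that adds the highest binary digit.
\<close>

lemma powr_top_bit_concave:
  fixes a b s :: real
  assumes "0 < s" "s \<le> 1" "0 \<le> b" "b \<le> a" "0 < a"
  shows "(2 powr s - 1) * a powr s + b powr s \<le> (a + b) powr s"
proof (cases "b = 0")
  case True
  have "2 powr s \<le> 2 powr 1" using assms by (intro powr_mono) auto
  with assms True show ?thesis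
    by (simp add: mult_right_le_one_le mult_left_le_one_le)
next
  case False
  define f where "f = (\<lambda>x. (a + x) powr s - x powr s)"
  have "f a \<le> f b"
  proof (rule DERIV_nonpos_imp_nonincreasing[where f = f])
    fix x assume x: "b \<le> x" "x \<le> a"
    with assms False have pos: "0 < x" "0 < a + x" by auto
    have "(f has_real_derivative s * (a + x) powr (s - 1) - s * x powr (s - 1)) (at x)"
      unfolding f_def using pos by (auto intro!: derivative_eq_intros)
    moreover have "(a + x) powr (s - 1) \<le> x powr (s - 1)"
      using assms pos by (intro powr_mono2') auto
    then have "s * (a + x) powr (s - 1) - s * x powr (s - 1) \<le> 0"
      using assms by (simp add: mult_left_mono)
    ultimately show "\<exists>y. (f has_real_derivative y) (at x) \<and> y \<le> 0"
      by blast
  qed (use assms in auto)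
  moreover have "(a + a) powr s = 2 powr s * a powr s"
    using assms powr_mult[of 2 a s] by (simp add: mult_2[symmetric])
  ultimately show ?thesis by (simp add: f_def algebra_simps)
qed

text \<open>
  The same comparison for \<open>s \<ge> 1\<close>, where \<open>(1 + x)\<^sup>s - x\<^sup>s\<close> is nondecreasing.
\<close>

lemma powr_top_bit_convex:
  fixes a b s :: real
  assumes "1 \<le> s" "0 \<le> b" "b \<le> a" "0 < a"
  shows "(2 powr s - 1) * a powr s + b powr s \<ge> (a + b) powr s"
proof (cases "b = 0")
  case True
  have "2 powr s \<ge> 2 powr 1" using assms by (intro powr_mono) auto
  then have "1 * a powr s \<le> (2 powr s - 1) * a powr s" by (intro mult_right_mono) auto
  with assms True show ?thesis by simp
next
  case False
  define f where "f = (\<lambda>x. (a + x) powr s - x powr s)"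
  have "f a \<ge> f b"
  proof (rule DERIV_nonneg_imp_nondecreasing[where f = f])
    fix x assume x: "b \<le> x" "x \<le> a"
    with assms False have pos: "0 < x" "0 < a + x" by auto
    have "(f has_real_derivative s * (a + x) powr (s - 1) - s * x powr (s - 1)) (at x)"
      unfolding f_def using pos by (auto intro!: derivative_eq_intros)
    moreover have "(a + x) powr (s - 1) \<ge> x powr (s - 1)"
      using assms pos by (intro powr_mono2) auto
    then have "s * (a + x) powr (s - 1) - s * x powr (s - 1) \<ge> 0"
      using assms by (simp add: mult_left_mono)
    ultimately show "\<exists>y. (f has_real_derivative y) (at x) \<and> y \<ge> 0"
      by blast
  qed (use assms in auto)
  moreover have "(a + a) powr s = 2 powr s * a powr s"
    using assms powr_mult[of 2 a s] by (simp add: mult_2[symmetric])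
  ultimately show ?thesis by (simp add: f_def algebra_simps)
qed

text \<open>
  The entropy version: \<open>(a + x) ln (a + x) - x ln x\<close> increases in \<open>x\<close>, and at \<open>x = a\<close> it equals
  \<open>a ln a + 2 a ln 2\<close>.
\<close>

lemma mult_ln_top_bit:
  fixes a b :: real
  assumes "0 < b" "b \<le> a"
  shows "(a + b) * ln (a + b) \<le> a * ln a + b * ln b + 2 * ln 2 * a"
proof -
  define g where "g = (\<lambda>x. (a + x) * ln (a + x) - x * ln x)"
  have "g b \<le> g a"
  proof (rule DERIV_nonneg_imp_nondecreasing[where f = g])
    fix x assume x: "b \<le> x" "x \<le> a"
    with assms have pos: "0 < x" "0 < a + x" by auto
    have "(g has_real_derivative ln (a + x) - ln x) (at x)"
      unfolding g_def using pos by (auto intro!: derivative_eq_intros)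
    moreover have "ln (a + x) \<ge> ln x"
      using assms pos by simp
    ultimately show "\<exists>y. (g has_real_derivative y) (at x) \<and> y \<ge> 0"
      by (intro exI conjI) auto
  qed (use assms in auto)
  moreover have "ln (a + a) = ln 2 + ln a"
    using assms ln_mult[of 2 a] by (simp add: mult_2[symmetric])
  ultimately show ?thesis by (simp add: g_def algebra_simps)
qed

lemma bit_sum_powr_le:
  assumes "0 < s" "s \<le> 1"
  shows "(2 powr s - 1) * bit_sum (\<lambda>n. 2 powr (real n * s)) N \<le> real N powr s"
proof (induction N rule: binary_induct)
  case (top_bit n M)
  have "(2 powr s - 1) * (2 ^ n) powr s + real M powr s \<le> (2 ^ n + real M) powr s"
    using assms top_bit(1) by (intro powr_top_bit_concave) (simp_all add: less_imp_le)
  moreover have "bit_sum (\<lambda>n. 2 powr (real n * s)) (2 ^ n + M)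
      = (2 ^ n) powr s + bit_sum (\<lambda>n. 2 powr (real n * s)) M"
    by (simp only: bit_sum_top_bit[OF top_bit(1)] power_2_powr)
  ultimately show ?case
    using top_bit(2) by (simp add: distrib_left del: powr_gt_zero)
qed simp

lemma bit_sum_powr_ge:
  assumes "1 \<le> s"
  shows "(2 powr s - 1) * bit_sum (\<lambda>n. 2 powr (real n * s)) N \<ge> real N powr s"
proof (induction N rule: binary_induct)
  case (top_bit n M)
  have "(2 powr s - 1) * (2 ^ n) powr s + real M powr s \<ge> (2 ^ n + real M) powr s"
    using assms top_bit(1) by (intro powr_top_bit_convex) (simp_all add: less_imp_le)
  moreover have "bit_sum (\<lambda>n. 2 powr (real n * s)) (2 ^ n + M)
      = (2 ^ n) powr s + bit_sum (\<lambda>n. 2 powr (real n * s)) M"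
    by (simp only: bit_sum_top_bit[OF top_bit(1)] power_2_powr)
  ultimately show ?case
    using top_bit(2) by (simp add: distrib_left del: powr_gt_zero)
qed simp

lemma bit_sum_mult_ln_ge:
  "bit_sum (\<lambda>n. 2 ^ n * (real n * ln 2)) N \<ge> real N * ln (real N) - 2 * ln 2 * real N"
proof (induction N rule: binary_induct)
  case (top_bit n M)
  have lt: "real M \<le> 2 ^ n" using top_bit(1) by (simp add: less_imp_le)
  have "(2 ^ n + real M) * ln (2 ^ n + real M) \<le> 2 ^ n * ln (2 ^ n) + M * ln M + 2 * ln 2 * 2 ^ n"
  proof (cases "M = 0")
    case False
    with lt show ?thesis by (intro mult_ln_top_bit) auto
  qed simp
  with top_bit show ?case
    unfolding bit_sum_top_bit[OF top_bit(1)] by (simp add: ln_realpow algebra_simps)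
qed simp

lemma G_eta_le:
  assumes "0 < s" "s \<le> 1" "N > 0"
  shows "G (eta N) s \<le> 1 / (2 powr s - 1)"
  using bit_sum_powr_le[of s N] two_powr_gt_1[of s] assms
  by (simp add: G_eta field_simps)

lemma G_eta_ge:
  assumes "1 \<le> s" "N > 0"
  shows "G (eta N) s \<ge> 1 / (2 powr s - 1)"
  using bit_sum_powr_ge[of s N] two_powr_gt_1[of s] assms
  by (simp add: G_eta field_simps)

text \<open>
  A bound that serves all \<open>s > 0\<close> at once: for \<open>s > 1\<close> the components of \<open>\<eta>(N)\<close> are at most \<open>1\<close> and add
  up to \<open>1\<close>, so \<open>G \<le> 1\<close>.
\<close>

lemma G_eta_bounded:
  assumes "0 < s" "N > 0"
  shows "G (eta N) s \<le> 1 / (2 powr s - 1) + 1"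
proof (cases "s \<le> 1")
  case True
  then show ?thesis using G_eta_le[of s N] assms by simp
next
  case False
  have "G (eta N) s \<le> (\<Sum>t\<leftarrow>eta N. t)"
    unfolding G_def
  proof (rule sum_list_mono)
    fix t assume "t \<in> set (eta N)"
    then obtain n where n: "n \<in> set_decode N" "t = 2 ^ n / real N"
      using set_binary_exponents by (auto simp: eta_def)
    have "real N = (\<Sum>n\<in>set_decode N. 2 ^ n)" using bit_sum_power_2[of N] by (simp add: bit_sum_def)
    also have "\<dots> \<ge> 2 ^ n" using n by (intro member_le_sum) auto
    finally have "0 \<le> t" "t \<le> 1" unfolding n(2) using assms by (simp_all add: divide_le_eq_1)
    then show "t powr s \<le> t" using False powr_mono'[of 1 s t] by simp
  qed
  also have "(\<Sum>t\<leftarrow>eta N. t) = bit_sum (\<lambda>n. inverse N * 2 ^ n) N"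
    by (simp add: eta_def sum_list_binary_exponents comp_def field_simps)
  also have "\<dots> = 1" using assms by (simp add: bit_sum_cmult bit_sum_power_2)
  also have "1 \<le> 1 / (2 powr s - 1) + 1"
  proof -
    have "0 < 2 powr s - 1" using two_powr_gt_1[OF assms(1)] by linarith
    then have "0 \<le> 1 / (2 powr s - 1)" by (rule divide_nonneg_pos[OF zero_le_one])
    then show ?thesis by linarith
  qed
  finally show ?thesis .
qed

lemma Lambda_eta_ge:
  assumes "N > 0"
  shows "Lambda (eta N) \<ge> - 2 * ln 2"
  using bit_sum_mult_ln_ge[of N] assms by (simp add: Lambda_eta field_simps)

text \<open>
  For \<open>N = 2\<^sup>k - 1\<close> the vector \<open>\<eta>(N)\<close> tends to \<open>(1/2, 1/4, 1/8, \<dots>)\<close>, whose \<open>s\<close>-th powers form a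
  geometric series with sum \<open>1 / (2\<^sup>s - 1)\<close>.
\<close>

lemma G_eta_repunit_tendsto:
  assumes "0 < s"
  shows "(\<lambda>k. G (eta (2 ^ k - 1)) s) \<longlonglongrightarrow> 1 / (2 powr s - 1)"
proof -
  note gt = two_powr_gt_1[OF assms]
  have "\<forall>\<^sub>F k in sequentially. G (eta (2 ^ k - 1)) s
      = (1 - (1 / 2 powr s) ^ k) / (2 powr s - 1) / (1 - (1 / 2) ^ k) powr s"
    using eventually_gt_at_top[of 0]
  proof eventually_elim
    case (elim k)
    then have N: "(2::nat) ^ k - 1 > 0" using one_less_power[of "2::nat" k] by simp
    have R: "real (2 ^ k - 1) = 2 ^ k * (1 - (1 / 2) ^ k)"
      by (simp add: of_nat_diff algebra_simps power_one_over)
    have "bit_sum (\<lambda>n. 2 powr (real n * s)) (2 ^ k - 1) = (\<Sum>n<k. (2 powr s) ^ n)"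
      unfolding bit_sum_repunit by (simp add: powr_power mult.commute)
    also have "\<dots> = ((2 powr s) ^ k - 1) / (2 powr s - 1)"
      using gt by (subst geometric_sum) auto
    also have "\<dots> = (2 powr s) ^ k * ((1 - (1 / 2 powr s) ^ k) / (2 powr s - 1))"
      by (simp add: algebra_simps power_one_over)
    finally have "G (eta (2 ^ k - 1)) s = (2 powr s) ^ k * ((1 - (1 / 2 powr s) ^ k) / (2 powr s - 1))
       / (2 ^ k * (1 - (1 / 2) ^ k)) powr s"
      using N by (simp only: G_eta R)
    also have "(2 ^ k * (1 - (1 / 2) ^ k)) powr s = (2 powr s) ^ k * (1 - (1 / 2::real) ^ k) powr s"
      by (simp add: powr_mult power_2_powr powr_power mult.commute power_le_one)
    finally show ?case by simp
  qed
  moreover have "(\<lambda>k. (1 - (1 / 2 powr s) ^ k) / (2 powr s - 1) / (1 - (1 / 2) ^ k) powr s)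
      \<longlonglongrightarrow> (1 - 0) / (2 powr s - 1) / (1 - 0) powr s"
    using gt by (intro tendsto_intros LIMSEQ_realpow_zero) auto
  ultimately show ?thesis by (simp add: tendsto_cong)
qed

lemma Lambda_eta_repunit_tendsto: "(\<lambda>k. Lambda (eta (2 ^ k - 1))) \<longlonglongrightarrow> - 2 * ln 2"
proof -
  have sum: "(\<Sum>n<k. 2 ^ n * (real n * ln 2)) = ln 2 * ((real k - 2) * 2 ^ k + 2)" for k
    by (induction k) (simp_all add: algebra_simps)
  have "\<forall>\<^sub>F k in sequentially. Lambda (eta (2 ^ k - 1))
      = ln 2 * ((real k - 2) * 2 ^ k + 2) / (2 ^ k - 1) - ln (2 ^ k - 1)"
    using eventually_gt_at_top[of 0]
  proof eventually_elim
    case (elim k)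
    then have N: "(2::nat) ^ k - 1 > 0" using one_less_power[of "2::nat" k] by simp
    show ?case
      unfolding Lambda_eta[OF N] bit_sum_repunit sum by (simp add: of_nat_diff)
  qed
  moreover have "(\<lambda>k::nat. ln 2 * ((real k - 2) * 2 ^ k + 2) / (2 ^ k - 1) - ln (2 ^ k - 1)) \<longlonglongrightarrow> - 2 * ln 2"
    by real_asymp
  ultimately show ?thesis by (simp add: tendsto_cong)
qed

section \<open>The potential of the roots of a unimodular number\<close>

text \<open>
  The potential of \<open>m\<close> equally spaced points of the circle, at the middle of an arc between two
  neighbours.
\<close>

definition mid_sum :: "real \<Rightarrow> nat \<Rightarrow> real" where
  "mid_sum s m = (\<Sum>j<m. (2 * sin ((2 * real j + 1) * pi / (2 * real m))) powr (- s))"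

lemma mid_sum_nonneg: "mid_sum s m \<ge> 0"
  by (simp add: mid_sum_def sum_nonneg)

lemma cos_half_angle: "cos x = 1 - 2 * (sin (x / 2))\<^sup>2" for x :: real
  using cos_double_sin[of "x / 2"] by simp

lemma norm_cis_diff: "norm (cis x - cis y) = 2 * \<bar>sin ((x - y) / 2)\<bar>"
proof -
  have "(norm (cis x - cis y))\<^sup>2 = 2 - 2 * cos (x - y)"
    unfolding cmod_power2 cos_diff using sin_cos_squared_add[of x] sin_cos_squared_add[of y]
    by (simp add: power2_diff algebra_simps)
  also have "\<dots> = (2 * \<bar>sin ((x - y) / 2)\<bar>)\<^sup>2"
    unfolding cos_half_angle[of "x - y"] by (simp add: power_mult_distrib)
  finally show ?thesis
    by (rule power2_eq_imp_eq) auto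
qed

text \<open>
  Strict midpoint convexity of \<open>u \<mapsto> (2 sin u) powr (- s)\<close> on \<open>(0, \<pi>)\<close>. It follows from
  \<open>sin u sin v < sin\<^sup>2 ((u + v) / 2)\<close> and the inequality of arithmetic and geometric means.
\<close>

lemma sin_powr_midpoint_less:
  fixes u v s :: real
  assumes "0 < s" "0 < u" "u < pi" "0 < v" "v < pi" "u \<noteq> v"
  shows "2 * (2 * sin ((u + v) / 2)) powr (- s) < (2 * sin u) powr (- s) + (2 * sin v) powr (- s)"
proof -
  define A where "A = (2 * sin u) powr (- s / 2)"
  define B where "B = (2 * sin v) powr (- s / 2)"
  define m where "m = sin ((u + v) / 2)"
  have pos: "0 < sin u" "0 < sin v" "0 < m"
    unfolding m_def by (rule sin_gt_zero; use assms in simp)+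
  have prod: "m ^ 2 - sin u * sin v = (sin ((u - v) / 2))\<^sup>2"
    unfolding m_def sin_times_sin cos_half_angle[of "u - v"] cos_half_angle[of "u + v"]
    by (simp add: diff_divide_distrib)
  have AB: "A * B = (4 * (sin u * sin v)) powr (- s / 2)"
    using pos by (simp add: A_def B_def mult.assoc mult.left_commute flip: powr_mult)
  have M: "(2 * m) powr (- s) = (4 * m ^ 2) powr (- s / 2)"
  proof -
    have "(4 * m ^ 2) = (2 * m) powr 2" using pos by (simp add: power_mult_distrib)
    then show ?thesis by (simp only: powr_powr) simp
  qed
  have sq: "(2 * sin u) powr (- s) = A ^ 2" "(2 * sin v) powr (- s) = B ^ 2"
    by (simp_all add: A_def B_def power2_eq_square flip: powr_add)
  have amgm: "2 * (A * B) \<le> A ^ 2 + B ^ 2"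
    using zero_le_power2[of "A - B"] by (simp add: power2_diff)
  have "sin ((u - v) / 2) \<noteq> 0"
  proof (cases "u < v")
    case True
    then have "sin ((v - u) / 2) > 0" using assms by (intro sin_gt_zero) auto
    then show ?thesis by (metis minus_diff_eq minus_divide_left sin_minus neg_equal_0_iff_equal less_irrefl)
  next
    case False
    then have "sin ((u - v) / 2) > 0" using assms by (intro sin_gt_zero) auto
    then show ?thesis by simp
  qed
  then have "(sin ((u - v) / 2))\<^sup>2 > 0" by simp
  have "(2 * m) powr (- s) < A * B"
    unfolding AB M
  proof (rule powr_less_mono2_neg)
    show "4 * (sin u * sin v) < 4 * m\<^sup>2"
      using prod \<open>(sin ((u - v) / 2))\<^sup>2 > 0\<close> by linarith
  qed (use assms pos in auto)
  with amgm show ?thesis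
    unfolding sq m_def by linarith
qed

text \<open>
  The potential of \<open>m\<close> equally spaced points, at the point that has gone the angle \<open>2 t\<close> from one of
  them towards the next; \<open>0 < t < \<pi> / m\<close>, with \<open>t = \<pi> / (2 m)\<close> in the middle of the arc.
\<close>

definition arc_sum :: "real \<Rightarrow> nat \<Rightarrow> real \<Rightarrow> real" where
  "arc_sum s m t = (\<Sum>j<m. (2 * sin (t + real j * pi / real m)) powr (- s))"

lemma arc_sum_midpoint: "arc_sum s m (pi / (2 * real m)) = mid_sum s m"
  unfolding arc_sum_def mid_sum_def
  by (intro sum.cong arg_cong2[of _ _ _ _ "(powr)"] arg_cong2[of _ _ _ _ "(*)"] arg_cong[of _ _ sin] refl)
     (auto simp: field_simps)

text \<open>
  The reflection of an arc at its midpoint permutes the equally spaced points.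
\<close>

lemma arc_sum_reflect:
  assumes "m > 0"
  shows "arc_sum s m (pi / real m - t) = arc_sum s m t"
proof -
  have "arc_sum s m (pi / real m - t)
      = (\<Sum>j<m. (2 * sin (pi / real m - t + real (m - Suc j) * pi / real m)) powr (- s))"
    unfolding arc_sum_def by (rule sum.nat_diff_reindex[symmetric])
  also have "\<dots> = arc_sum s m t"
    unfolding arc_sum_def
  proof (intro sum.cong refl)
    fix j assume "j \<in> {..<m}"
    then have "pi / real m - t + real (m - Suc j) * pi / real m = pi - (t + real j * pi / real m)"
      using assms by (simp add: of_nat_diff field_simps)
    then show "(2 * sin (pi / real m - t + real (m - Suc j) * pi / real m)) powr (- s)
        = (2 * sin (t + real j * pi / real m)) powr (- s)"
      by (simp only: sin_pi_minus)
  qed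
  finally show ?thesis .
qed

lemma arc_angle_bounds:
  assumes "0 < t" "t < pi / real m" "j < m"
  shows "0 < t + real j * pi / real m" "t + real j * pi / real m < pi"
proof -
  show "0 < t + real j * pi / real m" using assms by (intro add_pos_nonneg) auto
  have "real j + 1 \<le> real m" using assms by linarith
  then have "(real j + 1) * pi \<le> real m * pi"
    by (intro mult_right_mono) auto
  then have "(real j + 1) * pi / real m \<le> pi"
    using assms by (simp add: field_simps)
  then show "t + real j * pi / real m < pi"
    using assms by (simp add: add_divide_distrib distrib_right)
qed

text \<open>
  By convexity, the mean of the equal values at \<open>t\<close> and at its mirror image exceeds the value halfway
  between them.
\<close>

lemma arc_sum_gt_mid_sum:
  assumes "0 < s" "0 < t" "t < pi / real m" "t \<noteq> pi / (2 * real m)"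
  shows "mid_sum s m < arc_sum s m t"
proof -
  have m: "m > 0" using assms by (cases m) auto
  define t' where "t' = pi / real m - t"
  have t': "0 < t'" "t' < pi / real m" "t \<noteq> t'"
    using assms m by (auto simp: t'_def field_simps)
  have "2 * mid_sum s m = 2 * arc_sum s m (pi / (2 * real m))"
    by (simp add: arc_sum_midpoint)
  also have "\<dots> < arc_sum s m t + arc_sum s m t'"
    unfolding arc_sum_def sum_distrib_left sum.distrib[symmetric]
  proof (rule sum_strict_mono)
    fix j assume j: "j \<in> {..<m}"
    have eq: "pi / (2 * real m) + real j * pi / real m
      = ((t + real j * pi / real m) + (t' + real j * pi / real m)) / 2"
      by (simp add: t'_def field_simps)
    show "2 * (2 * sin (pi / (2 * real m) + real j * pi / real m)) powr - s
      < (2 * sin (t + real j * pi / real m)) powr - s + (2 * sin (t' + real j * pi / real m)) powr - s"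
      unfolding eq using assms t' j
      by (intro sin_powr_midpoint_less arc_angle_bounds) auto
  qed (use m in auto)
  also have "arc_sum s m t' = arc_sum s m t"
    unfolding t'_def using m by (rule arc_sum_reflect)
  finally show ?thesis by simp
qed

lemma finite_roots: "m > 0 \<Longrightarrow> c \<noteq> 0 \<Longrightarrow> finite {z::complex. z ^ m = c}"
  using card_nth_roots[of c m] card_ge_0_finite by force

text \<open>
  The link between the circle and the angle \<open>t\<close>: if \<open>x\<^sup>m = c cis \<psi>\<close> with \<open>0 < \<psi> < 2 \<pi>\<close>, then \<open>x\<close> lies at angle
  \<open>\<psi> / m\<close> beyond the root \<open>z\<^sub>0\<close> of \<open>c\<close>, so \<open>t = \<psi> / (2 m)\<close>.
\<close>

lemma root_potential:
  assumes "0 < s" "m > 0" "norm c = 1" "norm x = 1" "x ^ m \<noteq> c"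
  obtains t where "0 < t" "t < pi / real m" "t = pi / (2 * real m) \<longleftrightarrow> x ^ m = - c"
    "(\<Sum>z | z ^ m = c. riesz_kernel s x z) = ennreal (arc_sum s m t)"
proof -
  have c0: "c \<noteq> 0" using assms by auto
  define psi where "psi = Arg2pi (x ^ m / c)"
  have psi: "x ^ m = c * cis psi"
  proof -
    have "norm (x ^ m / c) = 1" using assms by (simp add: norm_divide norm_power)
    then have "x ^ m / c = cis psi"
      unfolding psi_def using Arg2pi_eq[of "x ^ m / c"] by (simp add: cis_conv_exp)
    then show ?thesis using c0 by (simp add: field_simps)
  qed
  have psi_bounds: "0 < psi" "psi < 2 * pi"
  proof -
    have "psi \<noteq> 0" using psi assms by auto
    then show "0 < psi" using Arg2pi_ge_0[of "x ^ m / c"] by (simp add: psi_def)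
    show "psi < 2 * pi" by (simp add: psi_def Arg2pi_lt_2pi)
  qed
  define t where "t = psi / (2 * real m)"
  define z0 where "z0 = x * cis (- psi / real m)"
  have z0: "z0 ^ m = c" "norm z0 = 1"
  proof -
    have "real m * (- psi / real m) = - psi" using assms by simp
    then have "cis (- psi / real m) ^ m = cis (- psi)" 
      using Complex.DeMoivre[of "- psi / real m" m] by metis
    then have "z0 ^ m = c * cis psi * cis (- psi)"
      unfolding z0_def power_mult_distrib psi by simp
    then show "z0 ^ m = c" by (simp add: mult.assoc cis_mult)
    show "norm z0 = 1" using assms by (simp add: z0_def norm_mult)
  qed
  \<comment> \<open>The roots of \<open>c\<close>, listed clockwise from \<open>z0\<close>, so that every half angle from \<open>x\<close> is positive.\<close>
  define h where "h = (\<lambda>j::nat. z0 * cnj (cis (2 * pi * real j / real m)))"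
  have "inj_on h {..<m}"
  proof -
    have "inj_on (\<lambda>k. cis (2 * pi * real k / real m)) {..<m}"
      using Complex.bij_betw_roots_unity[OF assms(2)] by (simp add: bij_betw_def)
    then show ?thesis unfolding h_def inj_on_def using z0 by auto
  qed
  moreover have "h ` {..<m} = {z. z ^ m = c}"
  proof (rule card_subset_eq)
    show "finite {z. z ^ m = c}" using assms c0 by (intro finite_roots)
    show "h ` {..<m} \<subseteq> {z. z ^ m = c}"
    proof (rule image_subsetI)
      fix j assume "j \<in> {..<m}"
      then have "cis (2 * pi * real j / real m) ^ m = 1"
        using Complex.bij_betw_roots_unity[OF assms(2)] by (auto simp: bij_betw_def)
      then show "h j \<in> {z. z ^ m = c}"
        using z0 by (simp add: h_def power_mult_distrib flip: complex_cnj_power)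
    qed
    show "card (h ` {..<m}) = card {z. z ^ m = c}"
      using \<open>inj_on h {..<m}\<close> assms c0 by (simp add: card_image card_nth_roots)
  qed
  ultimately have bij: "bij_betw h {..<m} {z. z ^ m = c}" by (simp add: bij_betw_def)
  have tb: "0 < t" "t < pi / real m" using psi_bounds assms by (simp_all add: t_def field_simps)
  have kernel: "riesz_kernel s x (h j) = ennreal ((2 * sin (t + real j * pi / real m)) powr (- s))" if "j < m" for j
  proof -
    have x: "x = z0 * cis (psi / real m)"
      by (simp add: z0_def mult.assoc cis_mult)
    have "norm (x - h j) = norm (cis (psi / real m) - cis (- (2 * pi * real j / real m)))"
      unfolding x h_def cis_cnj right_diff_distrib[symmetric] norm_mult using z0 by simp
    also have "\<dots> = 2 * \<bar>sin (t + real j * pi / real m)\<bar>"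
    proof -
      have "(psi / real m - - (2 * pi * real j / real m)) / 2 = t + real j * pi / real m"
        by (simp add: t_def field_simps)
      then show ?thesis by (simp only: norm_cis_diff)
    qed
    also have "\<dots> = 2 * sin (t + real j * pi / real m)"
      using sin_gt_zero[OF arc_angle_bounds[OF tb that]] by simp
    finally have n: "norm (x - h j) = 2 * sin (t + real j * pi / real m)" .
    moreover have "sin (t + real j * pi / real m) > 0"
      by (rule sin_gt_zero[OF arc_angle_bounds[OF tb that]])
    ultimately have "x \<noteq> h j" by auto
    then show ?thesis by (simp add: riesz_kernel_def n)
  qed
  have "(\<Sum>z | z ^ m = c. riesz_kernel s x z) = (\<Sum>j<m. riesz_kernel s x (h j))"
    using sum.reindex_bij_betw[OF bij] by metis
  also have "\<dots> = ennreal (arc_sum s m t)"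
    by (simp add: kernel arc_sum_def sum_ennreal)
  finally have S: "(\<Sum>z | z ^ m = c. riesz_kernel s x z) = ennreal (arc_sum s m t)" .
  have "t = pi / (2 * real m) \<longleftrightarrow> psi = pi"
    using assms by (auto simp: t_def field_simps)
  also have "\<dots> \<longleftrightarrow> cis psi = -1"
  proof
    assume "cis psi = - 1"
    then have "cos psi = -1" by (simp add: complex_eq_iff)
    then show "psi = pi" using psi_bounds cos_minus_pi[of psi]
      by (smt (verit) cos_arccos_abs cos_inj_pi cos_periodic_pi2 cos_pi cos_2pi_minus pi_gt_zero)
  qed simp
  also have "\<dots> \<longleftrightarrow> x ^ m = - c"
    using psi c0 by (simp add: minus_equation_iff) (metis mult.right_neutral mult_cancel_left mult_minus_right)
  finally show ?thesis using that tb S by blast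
qed

lemma root_potential_midpoint:
  assumes "0 < s" "m > 0" "norm c = 1" "norm x = 1" "x ^ m = - c"
  shows "(\<Sum>z | z ^ m = c. riesz_kernel s x z) = ennreal (mid_sum s m)"
proof -
  have "x ^ m \<noteq> c" using assms by auto
  then show ?thesis using assms arc_sum_midpoint
    by (elim root_potential[OF assms(1-4)]) auto
qed

lemma root_potential_gt:
  assumes "0 < s" "m > 0" "norm c = 1" "norm x = 1" "x ^ m \<noteq> - c"
  shows "(\<Sum>z | z ^ m = c. riesz_kernel s x z) > ennreal (mid_sum s m)"
proof (cases "x ^ m = c")
  case True
  have fin: "finite {z::complex. z ^ m = c}" using assms by (intro finite_roots) auto
  have "riesz_kernel s x x \<le> (\<Sum>z | z ^ m = c. riesz_kernel s x z)"
    using True fin by (intro member_le_sum) auto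
  then have "(\<Sum>z | z ^ m = c. riesz_kernel s x z) = \<infinity>"
    by (simp add: riesz_kernel_def top_unique)
  then show ?thesis by simp
next
  case False
  obtain t where t: "0 < t" "t < pi / real m" "t = pi / (2 * real m) \<longleftrightarrow> x ^ m = - c"
    "(\<Sum>z | z ^ m = c. riesz_kernel s x z) = ennreal (arc_sum s m t)"
    by (rule root_potential[OF assms(1-4) False])
  show ?thesis
    unfolding t(4) using arc_sum_gt_mid_sum[OF assms(1) t(1,2)] t(3) assms(5) mid_sum_nonneg
    by (intro ennreal_lessI) (auto intro: le_less_trans)
qed

section \<open>The structure of greedy sequences\<close>

text \<open>
  The points that follow the first \<open>2\<^sup>n\<close> terms of a greedy sequence form a greedy sequence only as long
  as their number stays below \<open>2\<^sup>n\<close>. The induction on the structure therefore needs greediness up to a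
  given index; the index \<open>N\<close> itself is included.
\<close>

definition greedy_upto :: "real \<Rightarrow> (nat \<Rightarrow> complex) \<Rightarrow> nat \<Rightarrow> bool" where
  "greedy_upto s a N \<longleftrightarrow>
     a 0 \<in> unit_circle \<and>
     (\<forall>n. 1 \<le> n \<and> n \<le> N \<longrightarrow>
        a n \<in> unit_circle \<and> (\<forall>x\<in>unit_circle. potential a s n (a n) \<le> potential a s n x))"

lemma greedy_sequence_imp_upto: "greedy_sequence s a \<Longrightarrow> greedy_upto s a N"
  by (simp add: greedy_sequence_def greedy_upto_def)

lemma greedy_upto_mono: "greedy_upto s a N \<Longrightarrow> M \<le> N \<Longrightarrow> greedy_upto s a M"
  by (auto simp: greedy_upto_def)

lemma greedy_upto_norm: "greedy_upto s a N \<Longrightarrow> n \<le> N \<Longrightarrow> norm (a n) = 1"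
  by (cases "n = 0") (auto simp: greedy_upto_def)

lemma greedy_upto_minimal:
  assumes "greedy_upto s a N" "n \<le> N" "norm x = 1"
  shows "potential a s n (a n) \<le> potential a s n x"
  using assms by (cases "n = 0") (auto simp: greedy_upto_def potential_def)

lemma potential_cong:
  "(\<And>k. k < N \<Longrightarrow> a k = b k) \<Longrightarrow> potential a s N x = potential b s N x"
  by (simp add: potential_def)

lemma greedy_upto_extend:
  assumes "greedy_upto s b M" "norm y = 1"
    and "\<And>x. norm x = 1 \<Longrightarrow> potential b s (Suc M) y \<le> potential b s (Suc M) x"
  shows "greedy_upto s (b(Suc M := y)) (Suc M)"
proof -
  have "potential (b(Suc M := y)) s n x = potential b s n x" if "n \<le> Suc M" for n x
    using that by (intro potential_cong) auto
  then show ?thesis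
    using assms by (auto simp: greedy_upto_def le_Suc_eq)
qed

text \<open>
  In this form the kernel is visibly continuous, with values in the extended reals, also at its pole.
\<close>

lemma riesz_kernel_eq_inverse:
  assumes "s > 0"
  shows "riesz_kernel s x y = inverse (ennreal (norm (x - y) powr s))"
  using assms by (simp add: riesz_kernel_def inverse_ennreal powr_minus)

lemma continuous_on_potential:
  assumes "s > 0"
  shows "continuous_on A (potential a s N)"
  unfolding potential_def riesz_kernel_eq_inverse[OF assms]
  by (intro continuous_on_sum continuous_on_inverse_ennreal continuous_on_ennreal
       continuous_on_powr' continuous_intros) (use assms in auto)

text \<open>
  Existence of a minimizer is what allows a greedy prefix to be prolonged.
\<close>

lemma potential_attains_min:
  assumes "s > 0"
  obtains y where "norm y = 1" "\<And>x. norm x = 1 \<Longrightarrow> potential a s N y \<le> potential a s N x"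
proof -
  have "compact unit_circle" "unit_circle \<noteq> {}" by simp_all
  then obtain y where "y \<in> unit_circle" "\<forall>x\<in>unit_circle. potential a s N y \<le> potential a s N x"
    using continuous_attains_inf[OF _ _ continuous_on_potential[OF assms]] by blast
  then show ?thesis using that by auto
qed

lemma potential_less_top: "potential a s N x < top \<longleftrightarrow> x \<notin> a ` {..<N}"
  by (auto simp: potential_def riesz_kernel_def less_top)

lemma greedy_upto_finite:
  assumes "greedy_upto s a N" "n \<le> N"
  shows "potential a s n (a n) < top"
proof -
  have "card (a ` {..<n}) < card {z::complex. z ^ Suc n = 1}"
    using card_image_le[of "{..<n}" a] card_roots_unity_eq[of "Suc n"] by simp
  then have "\<not> {z. z ^ Suc n = 1} \<subseteq> a ` {..<n}"
    using card_mono[of "a ` {..<n}"] by (meson finite_imageI finite_lessThan not_le)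
  then obtain x where "x ^ Suc n = 1" "x \<notin> a ` {..<n}" by blast
  then have "norm x ^ Suc n = 1" by (metis norm_one norm_power)
  then have norm_x: "norm x = 1" using power_inject_base[of "norm x" n 1] by simp
  have "potential a s n x < top" using \<open>x \<notin> a ` {..<n}\<close> by (simp add: potential_less_top)
  with greedy_upto_minimal[OF assms, of x] norm_x show ?thesis
    by (auto intro: le_less_trans)
qed

lemma greedy_upto_inj:
  assumes "greedy_upto s a N"
  shows "inj_on a {..N}"
proof (rule linorder_inj_onI')
  fix i j assume "i \<in> {..N}" "j \<in> {..N}" "i < j"
  then have "potential a s j (a j) < top"
    by (intro greedy_upto_finite[OF assms]) simp
  then have "a j \<notin> a ` {..<j}" by (simp only: potential_less_top not_False_eq_True)
  with \<open>i < j\<close> show "a i \<noteq> a j" by (metis imageI lessThan_iff)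
qed

lemma potential_split:
  "potential a s (K + M) x = potential a s K x + potential (\<lambda>j. a (K + j)) s M x"
  by (induction M) (simp_all add: potential_def add.assoc)

text \<open>
  Put \<open>m = 2\<^sup>n\<close> and \<open>c = a 0 ^ m\<close>. The first \<open>m\<close> points are the \<open>m\<close>-th roots of \<open>c\<close>: the earlier cases give
  \<open>a j ^ m = c\<close> for all \<open>j < m\<close>, and the points are distinct because the potential is infinite at points
  already chosen. The potential at step \<open>N = m + M\<close> is the sum of the potential of these roots, whose
  minimizers are the \<open>m\<close>-th roots of \<open>- c\<close>, and the potential of the \<open>M < m\<close> later points. By induction,
  applied to the later points and one further minimizer, the second potential has a minimizer \<open>y\<close> with
  \<open>y\<^sup>m = - c\<close> as well. Thus both summands attain their minimum at a common point, and so \<open>a N\<close> has to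
  minimize each of them separately.
\<close>

lemma greedy_structure:
  assumes "s > 0" "greedy_upto s a N" "2 ^ n \<le> N" "N < 2 ^ Suc n"
  shows "bij_betw a {..<2 ^ n} {z. z ^ (2 ^ n) = a 0 ^ (2 ^ n)}
    \<and> a N ^ (2 ^ n) = - (a 0 ^ (2 ^ n))
    \<and> greedy_upto s (\<lambda>j. a (2 ^ n + j)) (N - 2 ^ n)"
  using assms(2-4)
proof (induction N arbitrary: a n rule: less_induct)
  case (less N)
  note greedy = \<open>greedy_upto s a N\<close>
  define m :: nat where "m = 2 ^ n"
  define c where "c = a 0 ^ m"
  have m: "m > 0" "m \<le> N" "N < 2 * m" using less.prems by (auto simp: m_def)
  have a0: "norm (a 0) = 1" using greedy greedy_upto_norm by blast
  then have c: "norm c = 1" "c \<noteq> 0" by (auto simp: c_def norm_power)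
  have bij: "bij_betw a {..<m} {z. z ^ m = c}"
    unfolding bij_betw_def
  proof
    show inj: "inj_on a {..<m}"
      by (rule inj_on_subset[OF greedy_upto_inj[OF greedy]]) (use m in auto)
    have "a j ^ m = c" if "j < m" for j
    proof (cases "j = 0")
      case False
      \<comment> \<open>The highest digit \<open>2 ^ k\<close> of \<open>j\<close> is smaller than \<open>m\<close>, so raising the identity at \<open>j\<close> to the
        even power \<open>m / 2 ^ k\<close> removes its sign.\<close>
      obtain k where k: "2 ^ k \<le> j" "j < 2 ^ Suc k"
        using ex_power_ivl1[of 2 j] False by auto
      have "2 ^ k < (2::nat) ^ n" using k that unfolding m_def by linarith
      then have "k < n" by simp
      then have mk: "m = 2 ^ k * 2 * 2 ^ (n - Suc k)"
        using power_add[of "2::nat" "Suc k" "n - Suc k"] by (simp add: m_def)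
      have "a j ^ (2 ^ k) = - (a 0 ^ (2 ^ k))"
        using less.IH[of j a k] k that m greedy greedy_upto_mono[of s a N j] by auto
      then show ?thesis
        unfolding c_def mk power_mult by simp
    qed (simp add: c_def)
    then have "a ` {..<m} \<subseteq> {z. z ^ m = c}" by auto
    then show "a ` {..<m} = {z. z ^ m = c}"
      using inj m c finite_roots[of m c] card_nth_roots[of c m]
      by (intro card_subset_eq) (auto simp: card_image)
  qed
  define M where "M = N - m"
  define b where "b = (\<lambda>j. a (m + j))"
  have M: "N = m + M" "M < m" using m by (auto simp: M_def)
  have pot: "potential a s m x = (\<Sum>z | z ^ m = c. riesz_kernel s x z)" for x
    unfolding potential_def using sum.reindex_bij_betw[OF bij] by metis
  have pot': "potential a s (m + M') x = (\<Sum>z | z ^ m = c. riesz_kernel s x z) + potential b s M' x" for M' x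
    unfolding potential_split pot b_def ..
  have b0: "norm (b 0) = 1" using greedy_upto_norm[OF greedy, of m] m by (simp add: b_def)
  have b_greedy: "greedy_upto s b M'" if "M' < M" for M'
    using less.IH[of "m + M'" a n] that M greedy greedy_upto_mono[of s a N "m + M'"]
    by (auto simp: b_def m_def)
  obtain y where y: "norm y = 1" "y ^ m = - c" "\<And>x. norm x = 1 \<Longrightarrow> potential b s M y \<le> potential b s M x"
  proof (cases M)
    case 0
    have "- c \<noteq> 0" using c by simp
    then have "{z. z ^ m = - c} \<noteq> {}"
      using card_nth_roots[of "- c" m] m by (metis card.empty less_irrefl)
    then obtain y where y: "y ^ m = - c" by blast
    then have "norm y ^ m = 1" using c by (metis norm_minus_cancel norm_power)
    then have "norm y = 1"
      using m power_eq_imp_eq_base[of "norm y" m 1] by simp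
    then show ?thesis using that y 0 by (simp add: potential_def)
  next
    case (Suc M')
    \<comment> \<open>Any minimizer \<open>y\<close> prolongs the greedy prefix \<open>b\<close>, so the induction hypothesis locates it among the
      \<open>m\<close>-th roots of \<open>b 0 ^ m = - c\<close>.\<close>
    obtain y where y: "norm y = 1" "\<And>x. norm x = 1 \<Longrightarrow> potential b s M y \<le> potential b s M x"
      using potential_attains_min[OF assms(1)] by blast
    have "greedy_upto s (b(M := y)) M"
      using greedy_upto_extend[of s b M' y] b_greedy[of M'] y Suc by auto
    moreover obtain k where k: "2 ^ k \<le> M" "M < 2 ^ Suc k"
      using ex_power_ivl1[of 2 M] Suc by auto
    ultimately have "y ^ (2 ^ k) = - (b 0 ^ (2 ^ k))"
      using less.IH[of M "b(M := y)" k] M m Suc by (auto simp del: fun_upd_apply simp: fun_upd_same fun_upd_other)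
    moreover have "m = 2 ^ k * 2 * 2 ^ (n - Suc k)"
    proof -
      have "2 ^ k < (2::nat) ^ n" using k M unfolding m_def by linarith
      then have "k < n" by simp
      then show ?thesis
        using power_add[of "2::nat" "Suc k" "n - Suc k"] by (simp add: m_def)
    qed
    ultimately have "y ^ m = b 0 ^ m" by (simp add: power_mult)
    moreover have "b 0 ^ m = - c"
      using less.IH[of m a n] M Suc greedy greedy_upto_mono[of s a N m] m
      by (auto simp: b_def m_def c_def)
    ultimately show ?thesis using that y by simp
  qed
  have aN: "norm (a N) = 1" using greedy_upto_norm[OF greedy, of N] by simp
  have U_y: "(\<Sum>z | z ^ m = c. riesz_kernel s y z) = ennreal (mid_sum s m)"
    using assms(1) m c y by (intro root_potential_midpoint) auto
  have U_aN: "(\<Sum>z | z ^ m = c. riesz_kernel s (a N) z) \<ge> ennreal (mid_sum s m)"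
    using root_potential_midpoint[of s m c "a N"] root_potential_gt[of s m c "a N"] assms(1) m c aN
    by (cases "a N ^ m = - c") auto
  have fin: "potential b s M (a N) < top" "(\<Sum>z | z ^ m = c. riesz_kernel s (a N) z) < top"
    using greedy_upto_finite[OF greedy, of N] unfolding M(1) pot' by auto
  have le: "(\<Sum>z | z ^ m = c. riesz_kernel s (a N) z) + potential b s M (a N)
      \<le> ennreal (mid_sum s m) + potential b s M y"
    using greedy_upto_minimal[OF greedy, of N y] y U_y unfolding M(1) pot' by simp
  have "(\<Sum>z | z ^ m = c. riesz_kernel s (a N) z) \<le> ennreal (mid_sum s m)"
  proof -
    note le
    also have "ennreal (mid_sum s m) + potential b s M y \<le> ennreal (mid_sum s m) + potential b s M (a N)"
      using y(3)[OF aN] by (rule add_left_mono)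
    finally show ?thesis
      using fin by (auto simp: add.commute[of _ "potential b s M (a N)"] ennreal_add_left_cancel_le)
  qed
  then have aN_mid: "a N ^ m = - c"
    using root_potential_gt[of s m c "a N"] assms(1) m c aN by (meson not_le)
  have "potential b s M (a N) \<le> potential b s M y"
    using le root_potential_midpoint[of s m c "a N"] assms(1) m c aN aN_mid
    by (simp add: ennreal_add_left_cancel_le)
  then have "potential b s M (b M) \<le> potential b s M x" if "norm x = 1" for x
    using y(3)[OF that] M(1) by (simp add: b_def)
  then have "greedy_upto s b M"
    using b0 b_greedy[of "M - 1"] aN M(1)
    by (cases M) (auto simp: greedy_upto_def le_Suc_eq b_def)
  with bij aN_mid show ?case
    by (simp add: m_def c_def b_def M_def)
qed

text \<open>
  Each binary digit \<open>2\<^sup>n\<close> of \<open>N\<close> contributes a complete set of \<open>2\<^sup>n\<close>-th roots, and \<open>a N\<close> sits in the middle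
  of an arc of every one of these sets.
\<close>

lemma greedy_potential:
  assumes "s > 0" "greedy_upto s a N"
  shows "potential a s N (a N) = ennreal (bit_sum (\<lambda>n. mid_sum s (2 ^ n)) N)"
  using assms(2)
proof (induction N arbitrary: a rule: binary_induct)
  case zero
  show ?case by (simp add: potential_def)
next
  case (top_bit n M)
  note str = greedy_structure[OF assms(1) top_bit.prems, of n]
  let ?m = "2 ^ n :: nat"
  have bij: "bij_betw a {..<?m} {z. z ^ ?m = a 0 ^ ?m}"
    and mid: "a (?m + M) ^ ?m = - (a 0 ^ ?m)"
    and gr: "greedy_upto s (\<lambda>j. a (?m + j)) M"
    using str top_bit.hyps by auto
  have norms: "norm (a 0) = 1" "norm (a (?m + M)) = 1"
    using greedy_upto_norm[OF top_bit.prems] by auto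
  have "potential a s (?m + M) (a (?m + M))
     = potential a s ?m (a (?m + M)) + potential (\<lambda>j. a (?m + j)) s M (a (?m + M))"
    by (rule potential_split)
  also have "potential a s ?m (a (?m + M)) = (\<Sum>z | z ^ ?m = a 0 ^ ?m. riesz_kernel s (a (?m + M)) z)"
    unfolding potential_def using sum.reindex_bij_betw[OF bij] by metis
  also have "\<dots> = ennreal (mid_sum s ?m)"
    using assms(1) norms mid by (intro root_potential_midpoint) (auto simp: norm_power)
  also have "potential (\<lambda>j. a (?m + j)) s M (a (?m + M)) = ennreal (bit_sum (\<lambda>n. mid_sum s (2 ^ n)) M)"
    using top_bit.IH[OF gr] .
  finally show ?case
    using mid_sum_nonneg
    by (simp add: bit_sum_top_bit[OF top_bit.hyps] ennreal_plus bit_sum_nonneg)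
qed

section \<open>Analytic continuation of the zeta function\<close>

text \<open>
  \<open>falling s k\<close> is the \<open>k\<close>-th derivative of \<open>x powr (1 - s)\<close> at \<open>1\<close>.
\<close>

definition falling :: "complex \<Rightarrow> nat \<Rightarrow> complex" where
  "falling s k = (\<Prod>j<k. 1 - s - of_nat j)"

lemma falling_Suc: "falling s (Suc k) = falling s k * (1 - s - of_nat k)"
  by (simp add: falling_def)

lemma holomorphic_on_falling [holomorphic_intros]: "(\<lambda>s. falling s k) holomorphic_on A"
  unfolding falling_def by (intro holomorphic_intros)

text \<open>
  The Taylor remainder of order \<open>K + 1\<close> for \<open>x powr (1 - s)\<close> between the points \<open>x = n + 1\<close> and
  \<open>n + 2\<close>. It is entire in \<open>s\<close> and of order \<open>n powr (- Re s - K - 1)\<close>, so its sum over \<open>n\<close> is holomorphic for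
  \<open>Re s > - K\<close>.
\<close>

definition zeta_rem :: "nat \<Rightarrow> nat \<Rightarrow> complex \<Rightarrow> complex" where
  "zeta_rem K n s = of_nat (Suc (Suc n)) powr (1 - s)
     - (\<Sum>i<Suc (Suc K). falling s i / fact i * of_nat (Suc n) powr (1 - s - of_nat i))"

lemma norm_zeta_rem_le:
  assumes "Re s > - real K - 1"
  shows "norm (zeta_rem K n s) \<le> norm (falling s (Suc (Suc K))) * real (Suc n) powr (- Re s - real K - 1)"
proof -
  define x where "x = real (Suc n)"
  define B where "B = norm (falling s (Suc (Suc K))) * x powr (- Re s - real K - 1)"
  define f where "f = (\<lambda>i z. falling s i * z powr (1 - s - of_nat i))"
  define S where "S = complex_of_real ` {x..x + 1}"
  have x: "x \<ge> 1" by (simp add: x_def)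
  have "norm (f 0 (of_real (x + 1)) - (\<Sum>i\<le>Suc K. f i (of_real x) * (of_real (x + 1) - of_real x) ^ i / fact i))
      \<le> B * norm (of_real (x + 1) - of_real x :: complex) ^ Suc (Suc K) / fact (Suc K)"
  proof (rule complex_Taylor)
    show "convex S" unfolding S_def
      by (intro convex_linear_image convex_real_interval bounded_linear.linear bounded_linear_of_real)
    show "of_real x \<in> S" "of_real (x + 1) \<in> S"
      unfolding S_def by (rule imageI, simp)+
    fix i z assume "z \<in> S" "i \<le> Suc K"
    then have "z \<notin> \<real>\<^sub>\<le>\<^sub>0" using x by (auto simp: S_def complex_nonpos_Reals_iff)
    then have "((\<lambda>z. z powr (1 - s - of_nat i)) has_field_derivative
        (1 - s - of_nat i) * z powr (1 - s - of_nat i - 1)) (at z within S)"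
      by (rule has_field_derivative_at_within[OF has_field_derivative_powr])
    then have "(f i has_field_derivative
        falling s i * ((1 - s - of_nat i) * z powr (1 - s - of_nat i - 1))) (at z within S)"
      unfolding f_def by (rule DERIV_cmult)
    moreover have "falling s i * ((1 - s - of_nat i) * z powr (1 - s - of_nat i - 1)) = f (Suc i) z"
    proof -
      have "1 - s - of_nat i - 1 = 1 - s - of_nat (Suc i)" by simp
      then show ?thesis unfolding f_def falling_Suc by (simp only: mult.assoc)
    qed
    ultimately show "(f i has_field_derivative f (Suc i) z) (at z within S)" by simp
  next
    fix z assume "z \<in> S"
    then obtain t where t: "z = of_real t" "x \<le> t" by (auto simp: S_def)
    have "norm (z powr (1 - s - of_nat (Suc (Suc K)))) = t powr (- Re s - real K - 1)"
    proof -
      have "Re (1 - s - of_nat (Suc (Suc K))) = - Re s - real K - 1" by simp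
      then show ?thesis using t x by (simp only: norm_powr_real_powr Reals_of_real Re_complex_of_real)
    qed
    also have "\<dots> \<le> x powr (- Re s - real K - 1)"
      using t x assms by (intro powr_mono2') auto
    finally show "norm (f (Suc (Suc K)) z) \<le> B"
      unfolding f_def B_def norm_mult by (intro mult_left_mono) auto
  qed
  also have "B * norm (of_real (x + 1) - of_real x :: complex) ^ Suc (Suc K) / fact (Suc K) = B / fact (Suc K)"
    by simp
  also have "\<dots> \<le> B / 1"
    by (intro divide_left_mono) (auto simp: B_def fact_ge_1 simp del: fact_Suc)
  also have "f 0 (of_real (x + 1)) - (\<Sum>i\<le>Suc K. f i (of_real x) * (of_real (x + 1) - of_real x) ^ i / fact i)
      = zeta_rem K n s"
    unfolding zeta_rem_def f_def x_def lessThan_Suc_atMost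
    by (simp add: falling_def add.commute)
  finally show ?thesis by (simp add: B_def x_def)
qed

lemma summable_Suc_powr: "e < -1 \<Longrightarrow> summable (\<lambda>n. real (Suc n) powr e)"
  using summable_Suc_iff[of "\<lambda>n. real n powr e"] summable_real_powr_iff[of e] by simp

lemma summable_zeta_rem:
  assumes "Re s > - real K"
  shows "summable (\<lambda>n. zeta_rem K n s)"
proof (rule summable_norm_cancel, rule summable_comparison_test')
  show "summable (\<lambda>n. norm (falling s (Suc (Suc K))) * real (Suc n) powr (- Re s - real K - 1))"
    using assms by (intro summable_mult summable_Suc_powr) auto
  show "norm (norm (zeta_rem K n s))
      \<le> norm (falling s (Suc (Suc K))) * real (Suc n) powr (- Re s - real K - 1)" for n
    using norm_zeta_rem_le[of K s n] assms by simp
qed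

lemma holomorphic_on_zeta_rem: "zeta_rem K n holomorphic_on A"
  unfolding zeta_rem_def by (intro holomorphic_intros) auto

lemma open_halfplane_Re: "open {s. Re s > c}"
  by (intro open_Collect_less continuous_intros)

lemma connected_halfplane_Re: "connected {s. Re s > c}"
  by (intro convex_connected convex_halfspace_Re_gt)

lemma holomorphic_on_zeta_rem_sum:
  "(\<lambda>s. \<Sum>n. zeta_rem K n s) holomorphic_on {s. Re s > - real K}"
proof (rule holomorphic_uniform_sequence)
  show "open {s. Re s > - real K}" by (rule open_halfplane_Re)
  show "(\<lambda>s. \<Sum>n<N. zeta_rem K n s) holomorphic_on {s. Re s > - real K}" for N
    by (intro holomorphic_on_sum holomorphic_on_zeta_rem)
  fix z assume "z \<in> {s. Re s > - real K}"
  then have z: "Re z > - real K" by simp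
  define d where "d = (Re z + real K) / 2"
  have d: "d > 0" using z by (simp add: d_def)
  have Re: "Re s \<ge> - real K + d" if "s \<in> cball z d" for s
  proof -
    have "\<bar>Re (z - s)\<bar> \<le> d" using that abs_Re_le_cmod[of "z - s"] by (simp add: dist_norm)
    then have "Re z - Re s \<le> d" by (simp add: abs_le_iff)
    moreover have "2 * d = Re z + real K" by (simp add: d_def)
    ultimately show ?thesis by linarith
  qed
  have "compact ((\<lambda>s. falling s (Suc (Suc K))) ` cball z d)"
    by (intro compact_continuous_image holomorphic_on_imp_continuous_on holomorphic_intros) simp
  then obtain C where C: "\<And>s. s \<in> cball z d \<Longrightarrow> norm (falling s (Suc (Suc K))) \<le> C"
    by (meson compact_imp_bounded bounded_iff image_eqI)
  have "uniform_limit (cball z d) (\<lambda>N s. \<Sum>n<N. zeta_rem K n s) (\<lambda>s. \<Sum>n. zeta_rem K n s) sequentially"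
  proof (rule Weierstrass_m_test)
    show "summable (\<lambda>n. C * real (Suc n) powr (- d - 1))"
      using d by (intro summable_mult summable_Suc_powr) auto
    fix n s assume s: "s \<in> cball z d"
    have "norm (zeta_rem K n s) \<le> norm (falling s (Suc (Suc K))) * real (Suc n) powr (- Re s - real K - 1)"
      using Re[OF s] d by (intro norm_zeta_rem_le) auto
    also have "\<dots> \<le> C * real (Suc n) powr (- d - 1)"
      using C[OF s] Re[OF s] by (intro mult_mono powr_mono) (auto intro: order_trans[OF norm_ge_zero])
    finally show "norm (zeta_rem K n s) \<le> C * real (Suc n) powr (- d - 1)" .
  qed
  moreover have "cball z d \<subseteq> {s. Re s > - real K}" using Re d by fastforce
  ultimately show "\<exists>d>0. cball z d \<subseteq> {s. Re s > - real K} \<and>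
      uniform_limit (cball z d) (\<lambda>N s. \<Sum>n<N. zeta_rem K n s) (\<lambda>s. \<Sum>n. zeta_rem K n s) sequentially"
    using d by blast
qed

definition zeta_series :: "complex \<Rightarrow> complex" where
  "zeta_series s = (\<Sum>n. 1 / of_nat (Suc n) powr s)"

lemma zeta_series_sums:
  assumes "Re s > 1"
  shows "(\<lambda>n. 1 / of_nat (Suc n) powr s) sums zeta_series s"
  unfolding zeta_series_def
proof (rule summable_sums, rule summable_norm_cancel, rule summable_comparison_test')
  show "summable (\<lambda>n. real (Suc n) powr (- Re s))" using assms by (intro summable_Suc_powr) auto
  show "norm (norm (1 / of_nat (Suc n) powr s)) \<le> real (Suc n) powr (- Re s)" for n
  proof -
    have "norm ((of_nat (Suc n) :: complex) powr s) = real (Suc n) powr Re s"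
      by (simp add: norm_powr_real_powr del: of_nat_Suc)
    then show ?thesis by (simp add: norm_divide powr_minus_divide del: of_nat_Suc)
  qed
qed

text \<open>
  Where the Dirichlet series converges, the remainders can be summed term by term: the differences
  of \<open>x powr (1 - s)\<close> telescope to \<open>- 1\<close>, and the Taylor terms become shifted values of zeta.
\<close>

lemma zeta_rem_sums:
  assumes "Re s > 1"
  shows "(\<lambda>n. zeta_rem K n s) sums
    (- 1 + (s - 1) * zeta_series s - (\<Sum>k<K. falling s (k + 2) / fact (k + 2) * zeta_series (s + of_nat k + 1)))"
proof -
  have lim: "(\<lambda>n. of_nat (Suc n) powr (1 - s)) \<longlonglongrightarrow> 0"
  proof (rule Lim_null_comparison)
    show "\<forall>\<^sub>F n in sequentially. norm (of_nat (Suc n) powr (1 - s)) \<le> real (Suc n) powr (1 - Re s)"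
      by (simp add: norm_powr_real_powr del: of_nat_Suc)
    show "(\<lambda>n. real (Suc n) powr (1 - Re s)) \<longlonglongrightarrow> 0"
      using assms by real_asymp
  qed
  have 1: "(\<lambda>n. of_nat (Suc (Suc n)) powr (1 - s) - of_nat (Suc n) powr (1 - s)) sums (0 - 1)"
    using telescope_sums[OF lim] by simp
  have 2: "(\<lambda>n. of_nat (Suc n) powr (1 - s - of_nat (Suc k))) sums zeta_series (s + of_nat k)" for k
  proof -
    have "(\<lambda>n. 1 / of_nat (Suc n) powr (s + of_nat k)) sums zeta_series (s + of_nat k)"
      using assms by (intro zeta_series_sums) auto
    moreover have "1 / of_nat (Suc n) powr (s + of_nat k)
        = (of_nat (Suc n) :: complex) powr (1 - s - of_nat (Suc k))" for n
      by (simp add: powr_minus[symmetric] inverse_eq_divide[symmetric] algebra_simps)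
    ultimately show ?thesis by simp
  qed
  have eq: "zeta_rem K n s = (of_nat (Suc (Suc n)) powr (1 - s) - of_nat (Suc n) powr (1 - s))
      + (s - 1) * of_nat (Suc n) powr (1 - s - of_nat (Suc 0))
      - (\<Sum>k<K. falling s (k + 2) / fact (k + 2) * of_nat (Suc n) powr (1 - s - of_nat (Suc (Suc k))))" for n
    unfolding zeta_rem_def sum.lessThan_Suc_shift
    by (simp add: falling_def algebra_simps del: of_nat_Suc fact_Suc)
  show ?thesis
    unfolding eq using 2[of 0] 2[of "Suc k" for k]
    by (intro sums_diff sums_add sums_mult sums_sum) (use 1 in \<open>simp_all add: add_ac\<close>)
qed

text \<open>
  Solved for \<open>(s - 1) * zeta s\<close>, the summed Taylor expansion expresses it through the values of the same
  function at \<open>s + 1, \<dots>, s + K\<close>. The factor \<open>s - 1\<close> keeps everything free of poles: the pole of the term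
  with \<open>zeta (s + k + 1)\<close> is cancelled by the last factor of \<open>falling s (k + 2)\<close>.
\<close>

lemma zeta_continuation_step:
  assumes "\<And>k. k < K \<Longrightarrow> (\<lambda>s. \<xi> (s + of_nat k + 1)) holomorphic_on {s. Re s > - real K}"
    and "\<And>s. Re s > 1 \<Longrightarrow> \<xi> s = (s - 1) * zeta_series s"
  shows "\<exists>\<xi>. \<xi> holomorphic_on {s. Re s > - real K} \<and> (\<forall>s. Re s > 1 \<longrightarrow> \<xi> s = (s - 1) * zeta_series s)"
proof (intro exI conjI allI impI)
  let ?\<xi> = "\<lambda>s. 1 - (\<Sum>k<K. falling s (k + 1) / fact (k + 2) * \<xi> (s + of_nat k + 1)) + (\<Sum>n. zeta_rem K n s)"
  show "?\<xi> holomorphic_on {s. Re s > - real K}"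
    using assms(1) by (intro holomorphic_intros holomorphic_on_zeta_rem_sum) auto
  fix s assume s: "Re s > 1"
  have "falling s (k + 2) * zeta_series (s + of_nat k + 1) = - falling s (k + 1) * \<xi> (s + of_nat k + 1)" for k
    using assms(2)[of "s + of_nat k + 1"] s by (simp add: falling_Suc numeral_2_eq_2 algebra_simps)
  then have "(\<Sum>k<K. falling s (k + 2) / fact (k + 2) * zeta_series (s + of_nat k + 1))
      = - (\<Sum>k<K. falling s (k + 1) / fact (k + 2) * \<xi> (s + of_nat k + 1))"
    unfolding sum_negf[symmetric] by (intro sum.cong refl) (simp del: fact_Suc add: field_simps)
  then show "?\<xi> s = (s - 1) * zeta_series s"
    using zeta_rem_sums[OF s, of K, THEN sums_unique] by (simp add: algebra_simps)
qed

lemma zeta_continuation_halfplane: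
  "\<exists>\<xi>. \<xi> holomorphic_on {s. Re s > - real K} \<and> (\<forall>s. Re s > 1 \<longrightarrow> \<xi> s = (s - 1) * zeta_series s)"
proof (induction K)
  case 0
  show ?case
    by (rule zeta_continuation_step[of 0 "\<lambda>s. (s - 1) * zeta_series s"]) auto
next
  case (Suc K)
  then obtain \<xi> where hol: "\<xi> holomorphic_on {s. Re s > - real K}"
    and eq: "\<And>s. Re s > 1 \<Longrightarrow> \<xi> s = (s - 1) * zeta_series s" by blast
  show ?case
  proof (rule zeta_continuation_step)
    fix k assume "k < Suc K"
    have "\<xi> \<circ> (\<lambda>s. s + of_nat k + 1) holomorphic_on {s. Re s > - real (Suc K)}"
      by (rule holomorphic_on_compose_gen[OF _ hol]) (auto intro!: holomorphic_intros)
    then show "(\<lambda>s. \<xi> (s + of_nat k + 1)) holomorphic_on {s. Re s > - real (Suc K)}"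
      by (simp add: comp_def)
  qed (rule eq)
qed

lemma zeta_continuation_unique:
  assumes "f holomorphic_on A" "g holomorphic_on A" "open A" "connected A" "{s. Re s > 1} \<subseteq> A"
    and "\<And>s. Re s > 1 \<Longrightarrow> f s = g s" "s \<in> A"
  shows "f s = g s"
proof (rule analytic_continuation_open[of "{s. Re s > 1}" A f g])
  show "{s. Re s > 1} \<noteq> {}"
  proof -
    have "(2::complex) \<in> {s. Re s > 1}" by simp
    then show ?thesis by blast
  qed
qed (use assms open_halfplane_Re in auto)

text \<open>
  The continuations to the half-planes \<open>Re s > - K\<close> agree by the identity theorem and can be glued.
\<close>

lemma zeta_continuation_exists:
  "\<exists>f. f holomorphic_on (- {1}) \<and> (\<forall>s. Re s > 1 \<longrightarrow> (\<lambda>n. 1 / of_nat (Suc n) powr s) sums f s)"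
proof -
  define H where "H = (\<lambda>K. {s. Re s > - real K})"
  obtain \<xi> where hol: "\<And>K. \<xi> K holomorphic_on H K"
    and eq: "\<And>K s. Re s > 1 \<Longrightarrow> \<xi> K s = (s - 1) * zeta_series s"
    using zeta_continuation_halfplane unfolding H_def by metis
  have agree: "\<xi> K s = \<xi> L s" if "K \<le> L" "s \<in> H K" for K L s
  proof (rule zeta_continuation_unique[of "\<xi> K" "H K" "\<xi> L"])
    show "\<xi> L holomorphic_on H K" by (rule holomorphic_on_subset[OF hol]) (use that in \<open>auto simp: H_def\<close>)
  qed (use hol eq that open_halfplane_Re connected_halfplane_Re in \<open>auto simp: H_def\<close>)
  \<comment> \<open>At \<open>s\<close>, any half-plane that contains \<open>s\<close> may be used; this choice does.\<close>
  define Xi where "Xi = (\<lambda>s. \<xi> (Suc (nat \<lceil>\<bar>Re s\<bar>\<rceil>)) s)"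
  have in_H: "s \<in> H (Suc (nat \<lceil>\<bar>Re s\<bar>\<rceil>))" for s
    unfolding H_def by simp linarith
  have Xi: "Xi s = \<xi> K s" if "s \<in> H K" for K s
    unfolding Xi_def using agree[of K _ s] agree[of _ K s] that in_H[of s] by (metis nat_le_linear)
  have "Xi holomorphic_on (\<Union>K. H K)"
  proof (rule holomorphic_on_UN_open)
    show "Xi holomorphic_on H K" for K
      using hol[of K] Xi by (metis holomorphic_transform)
    show "open (H K)" for K unfolding H_def by (rule open_halfplane_Re)
  qed
  moreover have "(\<Union>K. H K) = UNIV" using in_H by blast
  ultimately have "(\<lambda>s. Xi s / (s - 1)) holomorphic_on (- {1})"
    by (intro holomorphic_intros) (auto intro: holomorphic_on_subset)
  moreover have "(\<lambda>n. 1 / of_nat (Suc n) powr s) sums (Xi s / (s - 1))" if "Re s > 1" for s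
  proof -
    have "s \<in> H 0" "s \<noteq> 1" using that by (auto simp: H_def)
    then show ?thesis using zeta_series_sums[OF that] Xi[of s 0] eq[of s 0] that by simp
  qed
  ultimately show ?thesis by blast
qed

lemma holomorphic_on_zeta: "zeta holomorphic_on (- {1})"
  and zeta_sums: "Re s > 1 \<Longrightarrow> (\<lambda>n. 1 / of_nat (Suc n) powr s) sums zeta s"
  using someI_ex[OF zeta_continuation_exists] unfolding zeta_def by blast+

text \<open>
  The case \<open>K = 0\<close> of the expansion, which represents the zeta function on \<open>Re s > 0\<close>.
\<close>

lemma zeta_eq_zeta_rem:
  assumes "Re s > 0" "s \<noteq> 1"
  shows "(s - 1) * zeta s = 1 + (\<Sum>n. zeta_rem 0 n s)"
proof (rule zeta_continuation_unique[of "\<lambda>s. (s - 1) * zeta s" "{s. Re s > 0} - {1}" "\<lambda>s. 1 + (\<Sum>n. zeta_rem 0 n s)"])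
  show "(\<lambda>s. (s - 1) * zeta s) holomorphic_on {s. Re s > 0} - {1}"
    by (intro holomorphic_intros holomorphic_on_subset[OF holomorphic_on_zeta]) auto
  show "(\<lambda>s. 1 + (\<Sum>n. zeta_rem 0 n s)) holomorphic_on {s. Re s > 0} - {1}"
    using holomorphic_on_zeta_rem_sum[of 0]
    by (intro holomorphic_intros) (auto intro: holomorphic_on_subset)
  show "open ({s. Re s > 0} - {1})" by (intro open_delete open_halfplane_Re)
  show "connected ({s. Re s > 0} - {1})"
    by (intro connected_open_delete open_halfplane_Re connected_halfplane_Re) simp
  fix s :: complex assume s: "Re s > 1"
  have "zeta s = zeta_series s" using zeta_sums[OF s] zeta_series_sums[OF s] by (rule sums_unique2)
  then show "(s - 1) * zeta s = 1 + (\<Sum>n. zeta_rem 0 n s)"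
    using zeta_rem_sums[OF s, of 0, THEN sums_unique] by (simp add: diff_eq_eq add.commute)
qed (use assms in auto)

lemma zeta_real_gt_1_sums:
  assumes "s > 1"
  shows "(\<lambda>n. real (Suc n) powr (- s)) sums Re (zeta (of_real s))"
proof -
  have "(\<lambda>n. Re (1 / of_nat (Suc n) powr of_real s)) sums Re (zeta (of_real s))"
    using zeta_sums[of "of_real s"] assms by (intro sums_Re) auto
  moreover have "Re (1 / of_nat (Suc n) powr of_real s) = real (Suc n) powr (- s)" for n
  proof -
    have "(of_nat (Suc n) :: complex) powr of_real s = of_real (real (Suc n) powr s)"
      by (metis of_nat_0_le_iff of_real_of_nat_eq powr_of_real)
    then show ?thesis by (simp add: powr_minus_divide del: of_nat_Suc)
  qed
  ultimately show ?thesis by simp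
qed

text \<open>
  In the case \<open>K = 0\<close> the partial sums of the remainders are explicit: they compare
  \<open>\<Sum>n\<le>N. n powr (- s)\<close> with its integral.
\<close>

lemma zeta_real_less_1_limit:
  assumes "0 < s" "s < 1"
  shows "(\<lambda>N. (\<Sum>n<N. real (Suc n) powr (- s)) - real N powr (1 - s) / (1 - s))
     \<longlonglongrightarrow> Re (zeta (of_real s))"
proof -
  let ?s = "complex_of_real s"
  have powr: "(of_nat (Suc n) :: complex) powr of_real e = of_real (real (Suc n) powr e)" for n e
    by (metis of_nat_0_le_iff of_real_of_nat_eq powr_of_real)
  have rem: "zeta_rem 0 n ?s = of_real (real (Suc (Suc n)) powr (1 - s) - real (Suc n) powr (1 - s)
      - (1 - s) * real (Suc n) powr (- s))" for n
  proof -
    have "zeta_rem 0 n ?s = of_nat (Suc (Suc n)) powr of_real (1 - s) - of_nat (Suc n) powr of_real (1 - s)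
        - of_real (1 - s) * of_nat (Suc n) powr of_real (- s)"
      by (simp add: zeta_rem_def falling_def lessThan_Suc algebra_simps of_nat_1[unfolded One_nat_def]
          del: of_nat_Suc)
    then show ?thesis unfolding powr by simp
  qed
  have "(\<lambda>n. zeta_rem 0 n ?s) sums ((?s - 1) * zeta ?s - 1)"
    using zeta_eq_zeta_rem[of ?s] summable_sums[OF summable_zeta_rem[of 0 ?s]] assms by simp
  then have "(\<lambda>n. Re (zeta_rem 0 n ?s)) sums Re ((?s - 1) * zeta ?s - 1)" by (rule sums_Re)
  also have "Re ((?s - 1) * zeta ?s - 1) = (s - 1) * Re (zeta ?s) - 1" by simp
  finally have "(\<lambda>N. \<Sum>n<N. Re (zeta_rem 0 n ?s)) \<longlonglongrightarrow> (s - 1) * Re (zeta ?s) - 1"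
    by (simp add: sums_def)
  moreover have "(\<Sum>n<N. Re (zeta_rem 0 n ?s))
      = real (Suc N) powr (1 - s) - 1 - (1 - s) * (\<Sum>n<N. real (Suc n) powr (- s))" for N
    unfolding rem Re_complex_of_real
    by (induction N) (simp_all add: algebra_simps of_nat_1[unfolded One_nat_def] del: of_nat_Suc)
  ultimately have A: "(\<lambda>N. real (Suc N) powr (1 - s) - 1 - (1 - s) * (\<Sum>n<N. real (Suc n) powr (- s)))
      \<longlonglongrightarrow> (s - 1) * Re (zeta ?s) - 1" by simp
  have B: "(\<lambda>N. real (Suc N) powr (1 - s) - real N powr (1 - s)) \<longlonglongrightarrow> 0"
    using assms by real_asymp
  have "(\<lambda>N. ((real (Suc N) powr (1 - s) - real N powr (1 - s)) - 1
       - (real (Suc N) powr (1 - s) - 1 - (1 - s) * (\<Sum>n<N. real (Suc n) powr (- s)))) / (1 - s))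
      \<longlonglongrightarrow> ((0 - 1) - ((s - 1) * Re (zeta ?s) - 1)) / (1 - s)"
    by (rule tendsto_divide[OF tendsto_diff[OF tendsto_diff[OF B tendsto_const] A] tendsto_const])
      (use assms in auto)
  also have "((0 - 1) - ((s - 1) * Re (zeta ?s) - 1)) / (1 - s) = Re (zeta ?s)"
    using assms by (simp add: field_simps)
  finally show ?thesis
    by (rule Lim_transform_eventually) (use assms in \<open>auto simp: field_simps\<close>)
qed

text \<open>
  The summand decreases, so the sum stays below the integral from \<open>0\<close>.
\<close>

lemma zeta_real_less_1_nonpos:
  assumes "0 < s" "s < 1"
  shows "Re (zeta (of_real s)) \<le> 0"
proof (rule LIMSEQ_le_const2[OF zeta_real_less_1_limit[OF assms]], intro exI allI impI)
  fix N :: nat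
  have "(\<Sum>n<N. real (Suc n) powr (- s)) \<le> real N powr (1 - s) / (1 - s)"
  proof (induction N)
    case (Suc N)
    have "real (Suc N) powr (- s) \<le> real (Suc N) powr (1 - s) / (1 - s) - real N powr (1 - s) / (1 - s)"
    proof (cases "N = 0")
      case True
      then show ?thesis using assms by (simp add: field_simps)
    next
      case False
      define f where "f = (\<lambda>x. x powr (1 - s) / (1 - s))"
      have "\<exists>z>real N. z < real N + 1 \<and> f (real N + 1) - f (real N) = (real N + 1 - real N) * z powr (- s)"
      proof (rule MVT2)
        fix x assume "real N \<le> x" "x \<le> real N + 1"
        with False show "(f has_real_derivative x powr (- s)) (at x)"
          unfolding f_def using assms by (auto intro!: derivative_eq_intros)
      qed simp
      then obtain z where z: "real N < z" "z < real N + 1" "f (real N + 1) - f (real N) = z powr (- s)"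
        by auto
      have "(real N + 1) powr (- s) \<le> z powr (- s)"
        using z assms by (intro powr_mono2') auto
      with z show ?thesis by (simp add: f_def add.commute)
    qed
    with Suc show ?case by simp
  qed simp
  then show "(\<Sum>n<N. real (Suc n) powr (- s)) - real N powr (1 - s) / (1 - s) \<le> 0" by simp
qed

section \<open>Asymptotics of the midpoint sums\<close>

lemma sin_ge_x_cos:
  fixes x :: real
  assumes "0 \<le> x" "x \<le> pi"
  shows "x * cos x \<le> sin x"
proof -
  define f where "f = (\<lambda>x::real. sin x - x * cos x)"
  have "f 0 \<le> f x"
  proof (rule DERIV_nonneg_imp_nondecreasing[where f = f])
    fix y assume y: "0 \<le> y" "y \<le> x"
    have "(f has_real_derivative y * sin y) (at y)"
      unfolding f_def by (auto intro!: derivative_eq_intros)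
    moreover have "0 \<le> y * sin y" using y assms by (intro mult_nonneg_nonneg sin_ge_zero) auto
    ultimately show "\<exists>d. (f has_real_derivative d) (at y) \<and> 0 \<le> d" by blast
  qed (use assms in auto)
  then show ?thesis by (simp add: f_def)
qed

lemma sin_ge_x_cos_half:
  fixes u :: real
  assumes "0 \<le> u" "u \<le> pi"
  shows "u * (cos (u / 2))\<^sup>2 \<le> sin u"
proof -
  have "u / 2 * cos (u / 2) \<le> sin (u / 2)" using assms by (intro sin_ge_x_cos) auto
  moreover have "0 \<le> cos (u / 2)" using assms by (intro cos_ge_zero) auto
  ultimately have "u / 2 * cos (u / 2) * (2 * cos (u / 2)) \<le> sin (u / 2) * (2 * cos (u / 2))"
    by (intro mult_right_mono) auto
  then show ?thesis
    using sin_double[of "u / 2"] by (simp add: power2_eq_square algebra_simps)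
qed

lemma sin_ge_half:
  fixes u :: real
  assumes "0 \<le> u" "u \<le> pi / 2"
  shows "u / 2 \<le> sin u"
proof -
  have "0 \<le> cos u" using assms by (intro cos_ge_zero) auto
  then have "1 / 2 \<le> (cos (u / 2))\<^sup>2"
    using cos_double_cos[of "u / 2"] by simp
  then have "u * (1 / 2) \<le> u * (cos (u / 2))\<^sup>2" using assms by (intro mult_left_mono) auto
  with sin_ge_x_cos_half[of u] assms show ?thesis by simp
qed

text \<open>
  Halving the angle, \<open>sin u / u \<ge> cos\<^sup>2 (u / 2)\<close>, while \<open>cos u = 2 cos\<^sup>2 (u / 2) - 1 \<le> cos\<^sup>4 (u / 2)\<close>.
\<close>

lemma sin_quotient_square_ge_cos:
  fixes u :: real
  assumes "0 < u" "u \<le> pi / 2"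
  shows "cos u \<le> (sin u / u)\<^sup>2"
proof -
  define c where "c = (cos (u / 2))\<^sup>2"
  have "c \<le> sin u / u"
    using sin_ge_x_cos_half[of u] assms by (simp add: c_def field_simps)
  moreover have "0 \<le> c" by (simp add: c_def)
  ultimately have "c\<^sup>2 \<le> (sin u / u)\<^sup>2" by (intro power_mono)
  moreover have "cos u = 2 * c - 1" using cos_double_cos[of "u / 2"] by (simp add: c_def)
  moreover have "2 * c - 1 \<le> c\<^sup>2" using zero_le_power2[of "c - 1"] by (simp add: power2_diff)
  ultimately show ?thesis by linarith
qed

text \<open>
  Points of the circle at angle \<open>t\<close> have distance \<open>2 sin (t / 2)\<close>. Replacing this chord by the arc \<open>t\<close>
  isolates the singularity of the kernel: sums of \<open>t powr (- s)\<close> lead to the zeta function, and for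
  \<open>s \<le> 1\<close> the excess is bounded. Since \<open>0 powr (- s) = 0\<close>, the excess vanishes at \<open>0\<close>, which is its
  limit for \<open>0 < s \<le> 1\<close>.
\<close>

definition kernel_excess :: "real \<Rightarrow> real \<Rightarrow> real" where
  "kernel_excess s t = (2 * sin (t / 2)) powr (- s) - t powr (- s)"

lemma kernel_excess_0 [simp]: "kernel_excess s 0 = 0"
  by (simp add: kernel_excess_def)

lemma kernel_excess_nonneg:
  assumes "0 < s" "0 \<le> t" "t \<le> pi"
  shows "0 \<le> kernel_excess s t"
proof (cases "t = 0")
  case False
  then have "0 < sin (t / 2)" using assms by (intro sin_gt_zero) auto
  moreover have "sin (t / 2) \<le> t / 2" using assms by (intro sin_x_le_x) auto
  ultimately have "t powr (- s) \<le> (2 * sin (t / 2)) powr (- s)"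
    using assms False by (intro powr_mono2') auto
  then show ?thesis by (simp add: kernel_excess_def)
qed simp

text \<open>
  With \<open>u = t / 2\<close> the derivative is nonnegative as soon as \<open>cos u \<le> (sin u / u) powr (s + 1)\<close>. As
  \<open>sin u / u \<le> 1\<close> and \<open>s + 1 \<le> 2\<close>, the estimate with exponent \<open>2\<close> suffices.
\<close>

lemma mono_on_kernel_excess:
  assumes "0 < s" "s \<le> 1"
  shows "mono_on {0..pi} (kernel_excess s)"
proof (rule mono_onI)
  fix x y :: real assume xy: "x \<in> {0..pi}" "y \<in> {0..pi}" "x \<le> y"
  show "kernel_excess s x \<le> kernel_excess s y"
  proof (cases "x = 0")
    case True
    then show ?thesis using kernel_excess_nonneg[of s y] assms xy by simp
  next
    case False
    show ?thesis
    proof (rule DERIV_nonneg_imp_nondecreasing[where f = "kernel_excess s"])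
      fix t assume "x \<le> t" "t \<le> y"
      with xy False have t: "0 < t" "t \<le> pi" by auto
      define u where "u = t / 2"
      have u: "0 < u" "u \<le> pi / 2" "t = 2 * u" using t by (auto simp: u_def)
      have sin: "0 < sin u" "sin u \<le> u" using u by (auto intro!: sin_gt_zero sin_x_le_x)
      have "((\<lambda>t. (2 * sin (t / 2)) powr (- s)) has_real_derivative
          - s * (2 * sin (t / 2)) powr (- s - 1) * cos (t / 2)) (at t)"
        using sin unfolding u_def by (auto intro!: derivative_eq_intros)
      moreover have "((\<lambda>t. t powr (- s)) has_real_derivative - s * t powr (- s - 1)) (at t)"
        using t by (auto intro!: derivative_eq_intros)
      ultimately have deriv: "(kernel_excess s has_real_derivative
          - s * (2 * sin u) powr (- s - 1) * cos u - (- s * (2 * u) powr (- s - 1))) (at t)"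
        unfolding kernel_excess_def[abs_def] u(3)[symmetric] unfolding u_def by (rule DERIV_diff)
      have "cos u \<le> (sin u / u)\<^sup>2" using u by (intro sin_quotient_square_ge_cos) auto
      also have "\<dots> = (sin u / u) powr 2" using sin u by simp
      also have "\<dots> \<le> (sin u / u) powr (s + 1)"
        using sin u assms by (intro powr_mono') auto
      also have "\<dots> = ((2 * sin u) / (2 * u)) powr (s + 1)" by simp
      also have "\<dots> = (2 * u) powr (- s - 1) / (2 * sin u) powr (- s - 1)"
        using sin u powr_minus_divide[of "2 * u" "s + 1"] powr_minus_divide[of "2 * sin u" "s + 1"]
        by (simp only: powr_divide minus_add_distrib diff_conv_add_uminus) simp
      finally have "(2 * sin u) powr (- s - 1) * cos u \<le> (2 * u) powr (- s - 1)"
        using sin by (simp add: pos_le_divide_eq mult.commute)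
      then have "s * ((2 * sin u) powr (- s - 1) * cos u) \<le> s * (2 * u) powr (- s - 1)"
        using assms by (intro mult_left_mono) auto
      with deriv show "\<exists>d. (kernel_excess s has_real_derivative d) (at t) \<and> 0 \<le> d"
        by (intro exI conjI) (assumption, simp)
    qed (rule xy)
  qed
qed

text \<open>
  On every cell both the value at the midpoint and the mean of \<open>q\<close> lie between the values of \<open>q\<close> at the
  two ends; these gaps telescope.
\<close>

lemma midpoint_sum_monotone:
  fixes q :: "real \<Rightarrow> real"
  assumes "mono_on {0..a} q" "a > 0" "p > 0"
  shows "\<bar>(\<Sum>j<p. q (a * (2 * real j + 1) / (2 * real p))) - real p / a * integral {0..a} q\<bar> \<le> q a - q 0"
proof -
  define x where "x = (\<lambda>j. a * real j / real p)"
  have int: "q integrable_on {u..v}" if "0 \<le> u" "v \<le> a" for u v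
    using assms that by (intro integrable_on_mono_on) (auto intro: mono_on_subset)
  have xmono: "x k \<le> x (Suc k)" for k using assms by (simp add: x_def field_simps)
  have x0: "0 \<le> x k" for k using assms by (simp add: x_def)
  have xa: "x k \<le> a" if "k \<le> p" for k
  proof -
    have "a * real k \<le> a * real p" using assms that by (intro mult_left_mono) auto
    then show ?thesis using assms by (simp add: x_def divide_le_eq)
  qed
  have "\<bar>(\<Sum>j<k. q (a * (2 * real j + 1) / (2 * real p))) - real p / a * integral {0..x k} q\<bar>
      \<le> q (x k) - q 0" if "k \<le> p" for k
    using that
  proof (induction k)
    case 0
    then show ?case by (simp add: x_def)
  next
    case (Suc k)
    define m where "m = a * (2 * real k + 1) / (2 * real p)"
    define I where "I = real p / a * integral {x k..x (Suc k)} q"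
    have "x k \<le> m" "m \<le> x (Suc k)"
      using assms by (simp_all add: x_def m_def field_simps)
    with xa[of k] xa[of "Suc k"] Suc.prems
    have bounds: "x k \<le> m" "m \<le> x (Suc k)" "x (Suc k) \<le> a" "x k \<le> a" by auto
    have qb: "q (x k) \<le> q t" "q t \<le> q (x (Suc k))" if "t \<in> {x k..x (Suc k)}" for t
      using assms(1) that bounds x0[of k] by (auto simp: mono_on_def)
    have w: "x (Suc k) - x k = a / real p" by (simp add: x_def distrib_left add_divide_distrib)
    have "integral {x k..x (Suc k)} (\<lambda>t. q (x k)) \<le> integral {x k..x (Suc k)} q"
      using qb bounds x0[of k] by (intro integral_le int) auto
    then have "a / real p * q (x k) \<le> integral {x k..x (Suc k)} q"
      using xmono[of k] w by simp
    then have 1: "q (x k) \<le> I" unfolding I_def using assms by (simp add: field_simps)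
    have "integral {x k..x (Suc k)} q \<le> integral {x k..x (Suc k)} (\<lambda>t. q (x (Suc k)))"
      using qb bounds x0[of k] by (intro integral_le int) auto
    then have "integral {x k..x (Suc k)} q \<le> a / real p * q (x (Suc k))"
      using xmono[of k] w by simp
    then have 2: "I \<le> q (x (Suc k))" unfolding I_def using assms by (simp add: field_simps)
    have 3: "q (x k) \<le> q m" "q m \<le> q (x (Suc k))" using qb[of m] bounds by auto
    have "integral {0..x (Suc k)} q = integral {0..x k} q + integral {x k..x (Suc k)} q"
      using bounds x0 xmono by (intro Henstock_Kurzweil_Integration.integral_combine[symmetric] int) auto
    then have "real p / a * integral {0..x (Suc k)} q = real p / a * integral {0..x k} q + I"
      by (simp add: I_def distrib_left)
    with Suc 1 2 3 show ?case by (simp add: m_def[symmetric])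
  qed
  from this[of p] show ?thesis using assms by (simp add: x_def)
qed

lemma sum_lessThan_add: "(\<Sum>j<m + n. f j) = (\<Sum>j<m. f j) + (\<Sum>j<n. f (m + j))"
  for f :: "nat \<Rightarrow> 'a :: comm_monoid_add"
  by (induction n) (simp_all add: add.assoc)

text \<open>
  The arc midpoints lie symmetrically about a diameter, so only the angles below \<open>\<pi>\<close> are needed, and there
  the kernel has a single singularity.
\<close>

lemma mid_sum_double:
  assumes "p > 0"
  shows "mid_sum s (2 * p) = 2 * (\<Sum>j<p. (2 * sin (pi * (2 * real j + 1) / (2 * real p) / 2)) powr (- s))"
proof -
  define f where "f = (\<lambda>j. (2 * sin ((2 * real j + 1) * pi / (2 * real (2 * p)))) powr (- s))"
  have "mid_sum s (2 * p) = (\<Sum>j<p + p. f j)"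
    unfolding mid_sum_def f_def mult_2[of p, symmetric] ..
  also have "\<dots> = (\<Sum>j<p. f j) + (\<Sum>j<p. f (p + (p - Suc j)))"
    unfolding sum_lessThan_add sum.nat_diff_reindex[of "\<lambda>j. f (p + j)"] ..
  also have "(\<Sum>j<p. f (p + (p - Suc j))) = (\<Sum>j<p. f j)"
  proof (rule sum.cong[OF refl])
    fix j assume "j \<in> {..<p}"
    then have "(2 * real (p + (p - Suc j)) + 1) * pi / (2 * real (2 * p))
        = pi - (2 * real j + 1) * pi / (2 * real (2 * p))"
      by (simp add: of_nat_diff field_simps)
    then show "f (p + (p - Suc j)) = f j" unfolding f_def by (simp only: sin_pi_minus)
  qed
  also have "(\<Sum>j<p. f j) = (\<Sum>j<p. (2 * sin (pi * (2 * real j + 1) / (2 * real p) / 2)) powr (- s))"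
    by (simp add: f_def mult_ac)
  finally show ?thesis by simp
qed

lemma sum_odd_powr:
  "(\<Sum>j<p. (2 * real j + 1) powr (- s))
    = (\<Sum>n<2 * p. real (Suc n) powr (- s)) - 2 powr (- s) * (\<Sum>n<p. real (Suc n) powr (- s))"
proof (induction p)
  case (Suc p)
  have "real (Suc (Suc (2 * p))) powr (- s) = 2 powr (- s) * real (Suc p) powr (- s)"
    by (simp flip: powr_mult)
  with Suc show ?case by (simp add: algebra_simps)
qed simp

text \<open>
  The excess contributes a Riemann sum with error \<open>O(1)\<close>, which is \<open>o(m powr s)\<close> for \<open>m = 2 p\<close>; the arcs
  contribute a sum over odd numbers.
\<close>

lemma mid_sum_decompose:
  assumes "0 < s" "s \<le> 1" "p > 0"
  shows "\<bar>mid_sum s (2 * p) - 2 * (real (2 * p) / pi) powr s * (\<Sum>j<p. (2 * real j + 1) powr (- s))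
      - real (2 * p) / pi * integral {0..pi} (kernel_excess s)\<bar> \<le> 2 * kernel_excess s pi"
proof -
  define t where "t = (\<lambda>j. pi * (2 * real j + 1) / (2 * real p))"
  have "t j powr (- s) = (real (2 * p) / pi) powr s * (2 * real j + 1) powr (- s)" for j
  proof -
    have "(inverse A * B) powr (- s) = A powr s * B powr (- s)" if "A > 0" "B > 0" for A B :: real
      using that by (simp add: powr_mult powr_minus inverse_powr)
    note powr = this
    have "t j = inverse (real (2 * p) / pi) * (2 * real j + 1)" by (simp add: t_def)
    then have "t j powr (- s) = (inverse (real (2 * p) / pi) * (2 * real j + 1)) powr (- s)" by simp
    also have "\<dots> = (real (2 * p) / pi) powr s * (2 * real j + 1) powr (- s)"
      by (rule powr) (use assms(3) in auto)
    finally show ?thesis .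
  qed
  moreover have "mid_sum s (2 * p) = 2 * (\<Sum>j<p. t j powr (- s) + kernel_excess s (t j))"
    using assms(3) by (simp add: mid_sum_double kernel_excess_def t_def)
  ultimately have "mid_sum s (2 * p) - 2 * (real (2 * p) / pi) powr s * (\<Sum>j<p. (2 * real j + 1) powr (- s))
      - real (2 * p) / pi * integral {0..pi} (kernel_excess s)
     = 2 * ((\<Sum>j<p. kernel_excess s (t j)) - real p / pi * integral {0..pi} (kernel_excess s))"
    by (simp add: sum.distrib sum_distrib_left algebra_simps)
  moreover have "\<bar>(\<Sum>j<p. kernel_excess s (t j)) - real p / pi * integral {0..pi} (kernel_excess s)\<bar>
      \<le> kernel_excess s pi - kernel_excess s 0"
    unfolding t_def using assms by (intro midpoint_sum_monotone mono_on_kernel_excess) auto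
  ultimately show ?thesis by (simp add: abs_mult)
qed

text \<open>
  An antiderivative is \<open>ln (tan (t / 4) / t)\<close>, which tends to \<open>ln (1 / 4)\<close> at \<open>0\<close>.
\<close>

lemma integral_kernel_excess_1: "integral {0..pi} (kernel_excess 1) = ln (4 / pi)"
proof -
  define h where "h = (\<lambda>t::real. ln (sin (t / 4)) - ln (cos (t / 4)) - ln t)"
  define \<Phi> where "\<Phi> = (\<lambda>t::real. if t = 0 then ln (1 / 4) else h t)"
  have deriv: "(\<Phi> has_real_derivative kernel_excess 1 t) (at t)" if "0 < t" "t \<le> pi" for t
  proof -
    have pos: "0 < sin (t / 4)" "0 < cos (t / 4)"
      using that by (auto intro!: sin_gt_zero cos_gt_zero)
    have "(h has_real_derivative cos (t / 4) / (4 * sin (t / 4)) + sin (t / 4) / (4 * cos (t / 4)) - 1 / t) (at t)"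
      unfolding h_def using pos that
      by (auto intro!: derivative_eq_intros simp: field_simps)
        (simp flip: distrib_left power2_eq_square)
    moreover have "cos (t / 4) / (4 * sin (t / 4)) + sin (t / 4) / (4 * cos (t / 4)) = 1 / (2 * sin (t / 2))"
    proof -
      have "cos (t / 4) / (4 * sin (t / 4)) + sin (t / 4) / (4 * cos (t / 4))
          = ((cos (t / 4))\<^sup>2 + (sin (t / 4))\<^sup>2) / (4 * sin (t / 4) * cos (t / 4))"
        using pos by (simp add: field_simps power2_eq_square)
      also have "\<dots> = 1 / (2 * (2 * sin (t / 4) * cos (t / 4)))" by (simp add: mult.assoc)
      also have "2 * sin (t / 4) * cos (t / 4) = sin (t / 2)"
        using sin_double[of "t / 4"] by simp
      finally show ?thesis .
    qed
    moreover have "kernel_excess 1 t = 1 / (2 * sin (t / 2)) - 1 / t"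
    proof -
      have "0 < sin (t / 2)" using that by (intro sin_gt_zero) auto
      then show ?thesis using that by (simp add: kernel_excess_def powr_minus_divide)
    qed
    ultimately have "(h has_real_derivative kernel_excess 1 t) (at t)" by simp
    then show ?thesis
      by (rule has_field_derivative_transform_within_open[of _ _ _ "{0<..}"])
        (use that in \<open>auto simp: \<Phi>_def\<close>)
  qed
  have "continuous_on {0..pi} \<Phi>"
    unfolding continuous_on_eq_continuous_within
  proof
    fix t assume t: "t \<in> {0..pi}"
    show "continuous (at t within {0..pi}) \<Phi>"
    proof (cases "t = 0")
      case True
      have "(h \<longlongrightarrow> ln (1 / 4)) (at_right 0)" unfolding h_def by real_asymp
      then have "(\<Phi> \<longlongrightarrow> ln (1 / 4)) (at_right 0)"
        by (rule Lim_transform_eventually) (auto simp: \<Phi>_def eventually_at_filter)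
      then have "(\<Phi> \<longlongrightarrow> \<Phi> 0) (at_right 0)" by (simp add: \<Phi>_def)
      then show ?thesis
        unfolding True continuous_within using at_within_Icc_at_right[of 0 pi] by simp
    next
      case False
      then have "isCont \<Phi> t" using deriv[of t] t DERIV_isCont by auto
      then show ?thesis by (rule continuous_at_imp_continuous_at_within)
    qed
  qed
  then have "(kernel_excess 1 has_integral (\<Phi> pi - \<Phi> 0)) {0..pi}"
    using deriv by (intro fundamental_theorem_of_calculus_interior)
      (auto simp: has_real_derivative_iff_has_vector_derivative)
  moreover have "\<Phi> pi - \<Phi> 0 = ln (4 / pi)"
    by (simp add: \<Phi>_def h_def sin_45 cos_45 ln_div)
  ultimately show ?thesis by (simp add: integral_unique)
qed

text \<open>
  The mean of the Riesz kernel over the circle: the second summand is the integral of \<open>t powr (- s)\<close> over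
  \<open>[0, \<pi>]\<close>.
\<close>

definition circle_kernel_mean :: "real \<Rightarrow> real" where
  "circle_kernel_mean s = (integral {0..pi} (kernel_excess s) + pi powr (1 - s) / (1 - s)) / pi"

lemma filterlim_double: "filterlim (\<lambda>p::nat. 2 * p) at_top at_top"
  by (rule filterlim_subseq) (auto simp: strict_mono_def)

text \<open>
  The sum over odd numbers is \<open>Z(2p) - 2 powr (- s) * Z(p)\<close> for the partial sums \<open>Z\<close> of the divergent
  Dirichlet series. Its leading part, of order \<open>p powr (1 - s)\<close>, joins the integral of the excess to
  give \<open>m\<close> times the mean of the kernel, and the constant \<open>zeta s\<close> is left over with the factor
  \<open>1 - 2 powr (- s)\<close>.
\<close>

lemma mid_sum_limit_less_1:
  assumes "0 < s" "s < 1"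
  shows "(\<lambda>p. (mid_sum s (2 * p) - real (2 * p) * circle_kernel_mean s) / real (2 * p) powr s)
    \<longlonglongrightarrow> (2 powr s - 1) * (2 * Re (zeta (complex_of_real s)) / (2 * pi) powr s)"
proof -
  define c where "c = Re (zeta (complex_of_real s))"
  define J where "J = integral {0..pi} (kernel_excess s)"
  define Z where "Z = (\<lambda>N. \<Sum>n<N. real (Suc n) powr (- s))"
  define Od where "Od = (\<lambda>p. \<Sum>j<p. (2 * real j + 1) powr (- s))"
  define E where "E = (\<lambda>p. (mid_sum s (2 * p) - 2 * (real (2 * p) / pi) powr s * Od p - real (2 * p) / pi * J)
    / real (2 * p) powr s)"
  have Zlim: "(\<lambda>N. Z N - real N powr (1 - s) / (1 - s)) \<longlonglongrightarrow> c"
    unfolding Z_def c_def using assms by (rule zeta_real_less_1_limit)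
  have E: "E \<longlonglongrightarrow> 0"
  proof (rule Lim_null_comparison)
    show "\<forall>\<^sub>F p in sequentially. norm (E p) \<le> 2 * kernel_excess s pi / real (2 * p) powr s"
      using eventually_gt_at_top[of 0]
    proof eventually_elim
      case (elim p)
      then show ?case
        unfolding E_def J_def Od_def using mid_sum_decompose[of s p] assms
        by (simp add: divide_right_mono)
    qed
    show "(\<lambda>p. 2 * kernel_excess s pi / real (2 * p) powr s) \<longlonglongrightarrow> 0"
      using assms by real_asymp
  qed
  have D: "(\<lambda>p. (Z (2 * p) - real (2 * p) powr (1 - s) / (1 - s))
      - 2 powr (- s) * (Z p - real p powr (1 - s) / (1 - s))) \<longlonglongrightarrow> c - 2 powr (- s) * c"
    by (intro tendsto_intros Zlim filterlim_compose[OF Zlim filterlim_double])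
  have lim: "(\<lambda>p. E p + 2 * pi powr (- s) * ((Z (2 * p) - real (2 * p) powr (1 - s) / (1 - s))
      - 2 powr (- s) * (Z p - real p powr (1 - s) / (1 - s)))) \<longlonglongrightarrow> 0 + 2 * pi powr (- s) * (c - 2 powr (- s) * c)"
    by (rule tendsto_add[OF E tendsto_mult[OF tendsto_const D]])
  have "\<forall>\<^sub>F p in sequentially. E p + 2 * pi powr (- s) * ((Z (2 * p) - real (2 * p) powr (1 - s) / (1 - s))
      - 2 powr (- s) * (Z p - real p powr (1 - s) / (1 - s)))
     = (mid_sum s (2 * p) - real (2 * p) * circle_kernel_mean s) / real (2 * p) powr s"
    using eventually_gt_at_top[of 0]
  proof eventually_elim
    case (elim p)
    define m where "m = real (2 * p)"
    have m: "m > 0" using elim by (simp add: m_def)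
    have Od: "Od p = Z (2 * p) - 2 powr (- s) * Z p" unfolding Od_def Z_def by (rule sum_odd_powr)
    have p: "2 powr (- s) * real p powr (1 - s) = m powr (1 - s) / 2"
    proof -
      have "m powr (1 - s) = 2 powr (1 + - s) * real p powr (1 - s)"
        by (simp add: m_def powr_mult)
      also have "2 powr (1 + - s) = 2 * 2 powr (- s)" by (subst powr_add) simp
      finally show ?thesis by simp
    qed
    have "(Z (2 * p) - m powr (1 - s) / (1 - s)) - 2 powr (- s) * (Z p - real p powr (1 - s) / (1 - s))
        = Od p - m powr (1 - s) / (1 - s) + (2 powr (- s) * real p powr (1 - s)) / (1 - s)"
      by (simp add: Od right_diff_distrib)
    also have "\<dots> = Od p - m powr (1 - s) / (2 * (1 - s))"
    proof -
      have "y - x / d + x / 2 / d = y - x / (2 * d)" for x y d :: real by simp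
      then show ?thesis unfolding p .
    qed
    finally have 1: "(Z (2 * p) - m powr (1 - s) / (1 - s)) - 2 powr (- s) * (Z p - real p powr (1 - s) / (1 - s))
        = Od p - m powr (1 - s) / (2 * (1 - s))" .
    have 2: "m * circle_kernel_mean s = m / pi * J + m powr (1 - s) * m powr s * pi powr (- s) / (1 - s)"
    proof -
      have "pi powr (1 + - s) = pi * pi powr (- s)" by (subst powr_add) simp
      moreover have "m powr (1 - s) * m powr s = m" using m by (simp flip: powr_add)
      ultimately show ?thesis by (simp add: circle_kernel_mean_def J_def field_simps)
    qed
    have 3: "(m / pi) powr s = m powr s * pi powr (- s)"
      using m by (simp add: powr_divide powr_minus_divide)
    have 4: "m powr s > 0" using m by simp
    have "E p + 2 * pi powr (- s) * (Od p - m powr (1 - s) / (2 * (1 - s)))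
       = (mid_sum s (2 * p) - m * circle_kernel_mean s) / m powr s"
      unfolding E_def m_def[symmetric] 2 3 using 4 assms by (simp add: field_simps)
    then show ?case unfolding m_def[symmetric] 1 .
  qed
  from Lim_transform_eventually[OF lim this]
  have "(\<lambda>p. (mid_sum s (2 * p) - real (2 * p) * circle_kernel_mean s) / real (2 * p) powr s)
     \<longlonglongrightarrow> 2 * pi powr (- s) * (c - 2 powr (- s) * c)" by simp
  also have "2 * pi powr (- s) * (c - 2 powr (- s) * c) = (2 powr s - 1) * (2 * c / (2 * pi) powr s)"
    by (simp add: powr_mult powr_minus_divide field_simps)
  finally show ?thesis by (simp add: c_def)
qed

text \<open>
  The same computation with harmonic numbers in place of the partial sums.
\<close>

lemma mid_sum_limit_1:
  "(\<lambda>p. mid_sum 1 (2 * p) / real (2 * p) - ln (real (2 * p)) / pi)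
    \<longlonglongrightarrow> 1 / pi * (euler_mascheroni + ln (2 / pi) + 2 * ln 2)"
proof -
  define J where "J = integral {0..pi} (kernel_excess 1)"
  define Od where "Od = (\<lambda>p. \<Sum>j<p. (2 * real j + 1) powr (- 1))"
  define E where "E = (\<lambda>p. (mid_sum 1 (2 * p) - 2 * (real (2 * p) / pi) powr 1 * Od p - real (2 * p) / pi * J)
    / real (2 * p))"
  have E: "E \<longlonglongrightarrow> 0"
  proof (rule Lim_null_comparison)
    show "\<forall>\<^sub>F p in sequentially. norm (E p) \<le> 2 * kernel_excess 1 pi / real (2 * p)"
      using eventually_gt_at_top[of 0]
    proof eventually_elim
      case (elim p)
      then show ?case
        unfolding E_def J_def Od_def using divide_right_mono[OF mid_sum_decompose[of 1 p], of "real (2 * p)"]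
        by (simp add: abs_divide)
    qed
    show "(\<lambda>p. 2 * kernel_excess 1 pi / real (2 * p)) \<longlonglongrightarrow> 0" by real_asymp
  qed
  have D: "(\<lambda>p. (harm (2 * p) - ln (real (2 * p))) - (harm p - ln (real p)) / 2)
      \<longlonglongrightarrow> euler_mascheroni - euler_mascheroni / (2::real)"
    by (intro tendsto_intros euler_mascheroni_LIMSEQ filterlim_compose[OF euler_mascheroni_LIMSEQ filterlim_double]) auto
  have lim: "(\<lambda>p. E p + 2 / pi * ((harm (2 * p) - ln (real (2 * p))) - (harm p - ln (real p)) / 2) + (ln 2 + J) / pi)
      \<longlonglongrightarrow> 0 + 2 / pi * (euler_mascheroni - euler_mascheroni / 2) + (ln 2 + J) / pi"
    by (rule tendsto_add[OF tendsto_add[OF E tendsto_mult[OF tendsto_const D]] tendsto_const])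
  have "\<forall>\<^sub>F p in sequentially. E p + 2 / pi * ((harm (2 * p) - ln (real (2 * p))) - (harm p - ln (real p)) / 2) + (ln 2 + J) / pi
     = mid_sum 1 (2 * p) / real (2 * p) - ln (real (2 * p)) / pi"
    using eventually_gt_at_top[of 0]
  proof eventually_elim
    case (elim p)
    define m where "m = real (2 * p)"
    have m: "m > 0" using elim by (simp add: m_def)
    have harm: "harm N = (\<Sum>n<N. real (Suc n) powr (- 1))" for N
      by (simp add: harm_altdef powr_minus)
    have Od: "Od p = harm (2 * p) - harm p / 2"
      unfolding Od_def sum_odd_powr harm by (simp add: powr_minus)
    have ln: "ln (real p) = ln m - ln 2"
      using elim by (simp add: m_def ln_mult)
    show ?case
      unfolding E_def m_def[symmetric] Od ln using m by (simp add: field_simps)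
  qed
  from Lim_transform_eventually[OF lim this]
  have "(\<lambda>p. mid_sum 1 (2 * p) / real (2 * p) - ln (real (2 * p)) / pi)
     \<longlonglongrightarrow> 0 + 2 / pi * (euler_mascheroni - euler_mascheroni / 2) + (ln 2 + J) / pi" .
  also have "0 + 2 / pi * (euler_mascheroni - euler_mascheroni / 2) + (ln 2 + J) / pi
     = 1 / pi * (euler_mascheroni + ln (2 / pi) + 2 * ln 2)"
  proof -
    have "ln (4::real) = 2 * ln 2" using ln_realpow[of 2 2] by simp
    then show ?thesis by (simp add: J_def integral_kernel_excess_1 ln_div field_simps)
  qed
  finally show ?thesis .
qed

lemma sum_odd_powr_sums:
  assumes "s > 1"
  shows "(\<lambda>j. (2 * real j + 1) powr (- s)) sums ((1 - 2 powr (- s)) * Re (zeta (complex_of_real s)))"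
proof -
  let ?c = "Re (zeta (complex_of_real s))"
  have Z: "(\<lambda>N. \<Sum>n<N. real (Suc n) powr (- s)) \<longlonglongrightarrow> ?c"
    using zeta_real_gt_1_sums[OF assms] by (simp add: sums_def)
  have "(\<lambda>p. (\<Sum>n<2 * p. real (Suc n) powr (- s)) - 2 powr (- s) * (\<Sum>n<p. real (Suc n) powr (- s)))
      \<longlonglongrightarrow> ?c - 2 powr (- s) * ?c"
    by (intro tendsto_intros Z filterlim_compose[OF Z filterlim_double])
  then show ?thesis
    unfolding sums_def sum_odd_powr by (simp add: algebra_simps)
qed

text \<open>
  After division by \<open>m powr s\<close> with \<open>m = 2 p\<close>, the \<open>j\<close>-th term tends to \<open>(\<pi> (2 j + 1)) powr (- s)\<close> and is
  dominated by \<open>(j + 1) powr (- s)\<close>, because \<open>sin x \<ge> x / 2\<close> on \<open>[0, \<pi> / 2]\<close>. Hence the limit may be taken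
  under the sum.
\<close>

lemma mid_sum_limit_gt_1:
  assumes "s > 1"
  shows "(\<lambda>p. mid_sum s (2 * p) / real (2 * p) powr s)
    \<longlonglongrightarrow> (2 powr s - 1) * (2 * Re (zeta (complex_of_real s)) / (2 * pi) powr s)"
proof -
  let ?c = "Re (zeta (complex_of_real s))"
  define t where "t = (\<lambda>p j. pi * (2 * real j + 1) / (2 * real p))"
  define a where "a = (\<lambda>j p. if j < p then (real (2 * p) * (2 * sin (t p j / 2))) powr (- s) else 0)"
  have "eventually (\<lambda>p. summable (\<lambda>j. norm (a j p))) sequentially \<and>
      summable (\<lambda>j. norm ((pi * (2 * real j + 1)) powr (- s))) \<and>
      ((\<lambda>p. \<Sum>j. a j p) \<longlonglongrightarrow> (\<Sum>j. (pi * (2 * real j + 1)) powr (- s)))"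
  proof (rule tannerys_theorem)
    fix j :: nat
    define u where "u = pi * (2 * real j + 1)"
    have u: "u > 0" unfolding u_def by (intro mult_pos_pos) auto
    have "(\<lambda>p. real (2 * p) * (2 * sin (u / (2 * real p) / 2))) \<longlonglongrightarrow> u"
      using u by real_asymp
    then have "(\<lambda>p. (real (2 * p) * (2 * sin (u / (2 * real p) / 2))) powr (- s)) \<longlonglongrightarrow> u powr (- s)"
      using u by (intro tendsto_powr) auto
    then show "(\<lambda>p. a j p) \<longlonglongrightarrow> (pi * (2 * real j + 1)) powr (- s)"
      unfolding u_def[symmetric]
      by (rule Lim_transform_eventually)
        (use eventually_gt_at_top[of j] in eventually_elim, simp add: a_def t_def u_def)
  next
    have bound: "norm (a j p) \<le> real (Suc j) powr (- s)" for j p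
    proof (cases "j < p")
      case True
      have "(2 * real j + 1) / (2 * real p) \<le> 1" using True by (simp add: field_simps)
      then have "pi * ((2 * real j + 1) / (2 * real p)) \<le> pi * 1" by (intro mult_left_mono) auto
      then have "t p j \<le> pi" by (simp add: t_def)
      moreover have "0 \<le> t p j" by (simp add: t_def)
      ultimately have "t p j / 2 / 2 \<le> sin (t p j / 2)" by (intro sin_ge_half) auto
      then have "real (2 * p) * (t p j / 2) \<le> real (2 * p) * (2 * sin (t p j / 2))"
        by (intro mult_left_mono) auto
      moreover have "real (2 * p) * (t p j / 2) = pi / 2 * (2 * real j + 1)"
        using True by (simp add: t_def)
      moreover have "1 * (2 * real j + 1) \<le> pi / 2 * (2 * real j + 1)"
        using pi_gt3 by (intro mult_right_mono) auto
      ultimately have "real (Suc j) \<le> real (2 * p) * (2 * sin (t p j / 2))" by simp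
      then have "(real (2 * p) * (2 * sin (t p j / 2))) powr (- s) \<le> real (Suc j) powr (- s)"
        using assms by (intro powr_mono2') auto
      then show ?thesis using True by (simp add: a_def)
    qed (simp add: a_def)
    then show "\<forall>\<^sub>F (j, p) in at_top \<times>\<^sub>F sequentially. norm (a j p) \<le> real (Suc j) powr (- s)"
      by (intro always_eventually) auto
    show "summable (\<lambda>j. real (Suc j) powr (- s))" using assms by (intro summable_Suc_powr) auto
  qed simp
  then have lim: "(\<lambda>p. 2 * (\<Sum>j. a j p)) \<longlonglongrightarrow> 2 * (\<Sum>j. (pi * (2 * real j + 1)) powr (- s))"
    by (intro tendsto_intros) auto
  have "\<forall>\<^sub>F p in sequentially. 2 * (\<Sum>j. a j p) = mid_sum s (2 * p) / real (2 * p) powr s"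
    using eventually_gt_at_top[of 0]
  proof eventually_elim
    case (elim p)
    have "(\<Sum>j. a j p) = (\<Sum>j<p. a j p)"
      by (rule suminf_finite) (auto simp: a_def)
    also have "\<dots> = (\<Sum>j<p. (2 * sin (t p j / 2)) powr (- s) / real (2 * p) powr s)"
      proof (intro sum.cong refl)
      fix j assume "j \<in> {..<p}"
      then have "a j p = real (2 * p) powr (- s) * (2 * sin (t p j / 2)) powr (- s)"
        by (simp only: a_def powr_mult lessThan_iff if_True)
      then show "a j p = (2 * sin (t p j / 2)) powr (- s) / real (2 * p) powr s"
        by (simp add: powr_minus_divide)
    qed
    finally show ?case
      unfolding mid_sum_double[OF elim] t_def sum_divide_distrib[symmetric] by simp
  qed
  from Lim_transform_eventually[OF lim this]
  have "(\<lambda>p. mid_sum s (2 * p) / real (2 * p) powr s)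
     \<longlonglongrightarrow> 2 * (\<Sum>j. (pi * (2 * real j + 1)) powr (- s))" .
  also have "(\<Sum>j. (pi * (2 * real j + 1)) powr (- s)) = pi powr (- s) * ((1 - 2 powr (- s)) * ?c)"
    using sums_mult[OF sum_odd_powr_sums[OF assms], of "pi powr (- s)"]
    by (intro sums_unique[symmetric]) (simp add: powr_mult)
  also have "2 * (pi powr (- s) * ((1 - 2 powr (- s)) * ?c)) = (2 powr s - 1) * (2 * ?c / (2 * pi) powr s)"
    by (simp add: powr_mult powr_minus_divide field_simps)
  finally show ?thesis .
qed

section \<open>The energy of the circle\<close>

lemma borel_measurable_riesz_kernel [measurable]:
  assumes [measurable]: "f \<in> borel_measurable M"
  shows "(\<lambda>x. riesz_kernel s (f x) y) \<in> borel_measurable M"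
  unfolding riesz_kernel_def by measurable

lemma borel_measurable_cis [measurable]: "cis \<in> borel_measurable borel"
  by (intro borel_measurable_continuous_onI continuous_on_cis continuous_on_id)

text \<open>
  The part of the shifted interval that lies beyond \<open>P\<close> is moved back by one period.
\<close>

lemma nn_integral_periodic_shift:
  fixes g :: "real \<Rightarrow> ennreal"
  assumes [measurable]: "g \<in> borel_measurable borel" and per: "\<And>t. g (t + P) = g t"
    and b: "0 \<le> b" "b \<le> P"
  shows "(\<integral>\<^sup>+t. g t * indicator {0<..P} t \<partial>lborel) = (\<integral>\<^sup>+t. g (t + b) * indicator {0<..P} t \<partial>lborel)"
proof -
  have shift: "(\<integral>\<^sup>+t. g t * indicator {u + c<..v + c} t \<partial>lborel)
      = (\<integral>\<^sup>+t. g (t + c) * indicator {u<..v} t \<partial>lborel)" for u v c :: real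
  proof -
    have "(\<integral>\<^sup>+t. g t * indicator {u + c<..v + c} t \<partial>lborel)
        = (\<integral>\<^sup>+t. g (c + 1 * t) * indicator {u + c<..v + c} (c + 1 * t) \<partial>lborel)"
      using nn_integral_real_affine[of "\<lambda>t. g t * indicator {u + c<..v + c} t" 1 c] by simp
    also have "\<dots> = (\<integral>\<^sup>+t. g (t + c) * indicator {u<..v} t \<partial>lborel)"
      by (intro nn_integral_cong) (auto simp: add.commute split: split_indicator)
    finally show ?thesis .
  qed
  have split: "(\<integral>\<^sup>+t. g t * indicator {u<..w} t \<partial>lborel)
      = (\<integral>\<^sup>+t. g t * indicator {u<..v} t \<partial>lborel) + (\<integral>\<^sup>+t. g t * indicator {v<..w} t \<partial>lborel)"
    if "u \<le> v" "v \<le> w" for u v w :: real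
  proof -
    have "(\<integral>\<^sup>+t. g t * indicator {u<..w} t \<partial>lborel)
        = (\<integral>\<^sup>+t. g t * indicator {u<..v} t + g t * indicator {v<..w} t \<partial>lborel)"
      using that by (intro nn_integral_cong) (auto split: split_indicator)
    then show ?thesis by (simp add: nn_integral_add)
  qed
  have "(\<integral>\<^sup>+t. g (t + b) * indicator {0<..P} t \<partial>lborel) = (\<integral>\<^sup>+t. g t * indicator {0 + b<..P + b} t \<partial>lborel)"
    by (rule shift[symmetric])
  also have "\<dots> = (\<integral>\<^sup>+t. g t * indicator {b<..P} t \<partial>lborel) + (\<integral>\<^sup>+t. g t * indicator {0 + P<..b + P} t \<partial>lborel)"
    using split[of b P "b + P"] b by (simp add: add.commute)
  also have "(\<integral>\<^sup>+t. g t * indicator {0 + P<..b + P} t \<partial>lborel) = (\<integral>\<^sup>+t. g t * indicator {0<..b} t \<partial>lborel)"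
    unfolding shift per ..
  also have "(\<integral>\<^sup>+t. g t * indicator {b<..P} t \<partial>lborel) + (\<integral>\<^sup>+t. g t * indicator {0<..b} t \<partial>lborel)
      = (\<integral>\<^sup>+t. g t * indicator {0<..P} t \<partial>lborel)"
    using split[of 0 b P] b by (simp add: add.commute)
  finally show ?thesis ..
qed

lemma nn_integral_arclength:
  assumes [measurable]: "f \<in> borel_measurable borel"
  shows "(\<integral>\<^sup>+x. f x \<partial>arclength) = (\<integral>\<^sup>+t. f (cis t) * indicator {0<..2 * pi} t \<partial>lborel) / ennreal (2 * pi)"
proof -
  have "(\<integral>\<^sup>+x. f x \<partial>arclength) = (\<integral>\<^sup>+t. f (cis t) * indicator {0..2 * pi} t \<partial>lborel) / ennreal (2 * pi)"
    unfolding arclength_def by (simp add: nn_integral_distr nn_integral_uniform_measure)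
  also have "(\<integral>\<^sup>+t. f (cis t) * indicator {0..2 * pi} t \<partial>lborel)
      = (\<integral>\<^sup>+t. f (cis t) * indicator {0<..2 * pi} t \<partial>lborel)"
    by (rule nn_integral_cong_AE, rule eventually_mono[OF AE_lborel_singleton[of 0]])
      (auto split: split_indicator)
  finally show ?thesis .
qed

lemma has_integral_half_circle_kernel:
  assumes "0 < s" "s < 1"
  shows "((\<lambda>t. (2 * sin (t / 2)) powr (- s)) has_integral pi * circle_kernel_mean s) {0..pi}"
proof -
  have "kernel_excess s integrable_on {0..pi}"
    using assms by (intro integrable_on_mono_on mono_on_kernel_excess) auto
  then have "(kernel_excess s has_integral integral {0..pi} (kernel_excess s)) {0..pi}"
    by (rule integrable_integral)
  moreover have "((\<lambda>t. t powr (- s)) has_integral (pi powr (- s + 1) / (- s + 1))) {0..pi}"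
    using assms by (intro has_integral_powr_from_0) auto
  ultimately have "((\<lambda>t. kernel_excess s t + t powr (- s)) has_integral
      (integral {0..pi} (kernel_excess s) + pi powr (- s + 1) / (- s + 1))) {0..pi}"
    by (rule has_integral_add)
  then show ?thesis by (simp add: kernel_excess_def circle_kernel_mean_def add.commute)
qed

lemma circle_kernel_mean_nonneg:
  assumes "0 < s" "s < 1"
  shows "circle_kernel_mean s \<ge> 0"
  using has_integral_nonneg[OF has_integral_half_circle_kernel[OF assms]]
    mult_le_cancel_left_pos[OF pi_gt_zero, of 0 "circle_kernel_mean s"] by simp

lemma nn_integral_half_circle_kernel:
  assumes "0 < s" "s < 1"
  shows "(\<integral>\<^sup>+t. ennreal ((2 * sin (t / 2)) powr (- s)) * indicator {0<..pi} t \<partial>lborel) = ennreal (pi * circle_kernel_mean s)"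
proof -
  have "(\<integral>\<^sup>+t. ennreal ((2 * sin (t / 2)) powr (- s)) * indicator {0..pi} t \<partial>lborel) = ennreal (pi * circle_kernel_mean s)"
    using has_integral_half_circle_kernel[OF assms] by (intro nn_integral_has_integral_lebesgue') auto
  moreover have "(\<integral>\<^sup>+t. ennreal ((2 * sin (t / 2)) powr (- s)) * indicator {0..pi} t \<partial>lborel)
      = (\<integral>\<^sup>+t. ennreal ((2 * sin (t / 2)) powr (- s)) * indicator {0<..pi} t \<partial>lborel)"
    by (intro nn_integral_cong) (auto split: split_indicator simp: less_le)
  ultimately show ?thesis by simp
qed

text \<open>
  The two half circles contribute equally, by the reflection \<open>t \<mapsto> 2 \<pi> - t\<close>.
\<close>

lemma nn_integral_circle_kernel:
  assumes "0 < s" "s < 1"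
  shows "(\<integral>\<^sup>+t. riesz_kernel s (cis t) 1 * indicator {0<..2 * pi} t \<partial>lborel) = ennreal (2 * pi * circle_kernel_mean s)"
proof -
  define h where "h = (\<lambda>t. ennreal ((2 * sin (t / 2)) powr (- s)))"
  have h [measurable]: "h \<in> borel_measurable borel" unfolding h_def by measurable
  have kernel: "riesz_kernel s (cis t) 1 = h t" if "0 < t" "t < 2 * pi" for t
  proof -
    have "0 < sin (t / 2)" using that by (intro sin_gt_zero) auto
    then have "norm (cis t - 1) = 2 * sin (t / 2)" "norm (cis t - 1) > 0"
      using norm_cis_diff[of t 0] by auto
    then show ?thesis by (auto simp: riesz_kernel_def h_def)
  qed
  have "(\<integral>\<^sup>+t. riesz_kernel s (cis t) 1 * indicator {0<..2 * pi} t \<partial>lborel)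
      = (\<integral>\<^sup>+t. h t * indicator {0<..pi} t + h t * indicator {pi<..<2 * pi} t \<partial>lborel)"
    by (rule nn_integral_cong_AE, rule eventually_mono[OF AE_lborel_singleton[of "2 * pi"]])
      (auto simp: kernel less_le split: split_indicator)
  also have "\<dots> = (\<integral>\<^sup>+t. h t * indicator {0<..pi} t \<partial>lborel) + (\<integral>\<^sup>+t. h t * indicator {pi<..<2 * pi} t \<partial>lborel)"
    by (rule nn_integral_add) measurable
  also have "(\<integral>\<^sup>+t. h t * indicator {pi<..<2 * pi} t \<partial>lborel)
      = (\<integral>\<^sup>+t. h (2 * pi + - 1 * t) * indicator {pi<..<2 * pi} (2 * pi + - 1 * t) \<partial>lborel)"
    using nn_integral_real_affine[of "\<lambda>t. h t * indicator {pi<..<2 * pi} t" "- 1" "2 * pi"] by simp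
  also have "\<dots> = (\<integral>\<^sup>+t. h t * indicator {0<..pi} t \<partial>lborel)"
  proof (rule nn_integral_cong_AE, rule eventually_mono[OF AE_lborel_singleton[of pi]])
    fix t :: real assume "t \<noteq> pi"
    moreover have "h (2 * pi + - 1 * t) = h t"
    proof -
      have "(2 * pi + - 1 * t) / 2 = pi - t / 2" by simp
      then show ?thesis unfolding h_def by (simp only: sin_pi_minus)
    qed
    ultimately show "h (2 * pi + - 1 * t) * indicator {pi<..<2 * pi} (2 * pi + - 1 * t) = h t * indicator {0<..pi} t"
      by (auto split: split_indicator)
  qed
  also have "(\<integral>\<^sup>+t. h t * indicator {0<..pi} t \<partial>lborel) = ennreal (pi * circle_kernel_mean s)"
    unfolding h_def by (rule nn_integral_half_circle_kernel[OF assms])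
  also have "ennreal (pi * circle_kernel_mean s) + ennreal (pi * circle_kernel_mean s) = ennreal (2 * pi * circle_kernel_mean s)"
    using circle_kernel_mean_nonneg[OF assms] by (simp flip: ennreal_plus)
  finally show ?thesis .
qed

text \<open>
  By rotation invariance the potential of the arclength measure is constant on the circle; its value at
  \<open>1\<close> is the mean of the kernel.
\<close>

lemma circle_potential:
  assumes "0 < s" "s < 1" "norm y = 1"
  shows "(\<integral>\<^sup>+x. riesz_kernel s x y \<partial>arclength) = ennreal (circle_kernel_mean s)"
proof -
  define b where "b = Arg2pi y"
  have y: "y = cis b" using Arg2pi_eq[of y] assms by (simp add: b_def cis_conv_exp)
  have b: "0 \<le> b" "b \<le> 2 * pi" using Arg2pi_ge_0 Arg2pi_lt_2pi less_imp_le unfolding b_def by auto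
  have rot: "riesz_kernel s (cis (t + b)) y = riesz_kernel s (cis t) 1" for t
  proof -
    have "cis (t + b) - y = (cis t - 1) * cis b" by (simp add: y algebra_simps cis_mult)
    then have "norm (cis (t + b) - y) = norm (cis t - 1)" by (simp add: norm_mult)
    then show ?thesis unfolding riesz_kernel_def by (metis eq_iff_diff_eq_0 norm_eq_zero)
  qed
  have "(\<integral>\<^sup>+t. riesz_kernel s (cis t) y * indicator {0<..2 * pi} t \<partial>lborel)
      = (\<integral>\<^sup>+t. riesz_kernel s (cis (t + b)) y * indicator {0<..2 * pi} t \<partial>lborel)"
    using b by (intro nn_integral_periodic_shift) (auto simp: cis_mult[symmetric])
  also have "\<dots> = ennreal (2 * pi * circle_kernel_mean s)"
    unfolding rot by (rule nn_integral_circle_kernel[OF assms(1,2)])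
  finally show ?thesis
    using circle_kernel_mean_nonneg[OF assms(1,2)] by (simp add: nn_integral_arclength divide_ennreal)
qed

lemma circle_energy_eq:
  assumes "0 < s" "s < 1"
  shows "circle_energy s = ennreal (circle_kernel_mean s)"
proof -
  have "AE y in arclength. norm y = 1"
    unfolding arclength_def by (subst AE_distr_iff) auto
  then have "circle_energy s = (\<integral>\<^sup>+y. ennreal (circle_kernel_mean s) \<partial>arclength)"
    unfolding circle_energy_def
    by (intro nn_integral_cong_AE, elim eventually_mono) (rule circle_potential[OF assms])
  also have "\<dots> = (\<integral>\<^sup>+t. ennreal (circle_kernel_mean s) * indicator {0<..2 * pi} t \<partial>lborel) / ennreal (2 * pi)"
    by (rule nn_integral_arclength) simp
  also have "\<dots> = ennreal (circle_kernel_mean s)"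
    using circle_kernel_mean_nonneg[OF assms]
    by (simp add: nn_integral_cmult_indicator divide_ennreal flip: ennreal_mult)
  finally show ?thesis .
qed

section \<open>The lower limits\<close>

text \<open>
  Errors \<open>o(m powr s)\<close> in the contributions of the digits \<open>m = 2\<^sup>n\<close> add up to \<open>o(N powr s)\<close>: the
  finitely many small digits contribute a bounded amount, and the large ones at most a small multiple
  of \<open>N powr s * G (eta N) s\<close>, where \<open>G\<close> is bounded.
\<close>

lemma bit_sum_null:
  assumes "s > 0" "e \<longlonglongrightarrow> 0"
  shows "(\<lambda>N. bit_sum (\<lambda>n. 2 powr (real n * s) * e n) N / real N powr s) \<longlonglongrightarrow> 0"
proof (rule LIMSEQ_I)
  fix \<epsilon> :: real assume \<epsilon>: "\<epsilon> > 0"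
  define C where "C = 1 / (2 powr s - 1) + 1"
  have "0 < 2 powr s - 1" using two_powr_gt_1[OF assms(1)] by linarith
  then have C: "C > 0" unfolding C_def by (intro add_pos_pos divide_pos_pos) auto
  define \<delta> where "\<delta> = \<epsilon> / (2 * C)"
  have \<delta>: "\<delta> > 0" using \<epsilon> C by (simp add: \<delta>_def)
  obtain m where m: "\<And>n. n \<ge> m \<Longrightarrow> \<bar>e n\<bar> < \<delta>"
    using LIMSEQ_D[OF assms(2) \<delta>] by auto
  define d where "d = (\<lambda>n. if n < m then 2 powr (real n * s) * \<bar>e n\<bar> else 0)"
  define D where "D = (\<Sum>n<m. d n)"
  have d: "0 \<le> d n" for n by (simp add: d_def)
  have bound: "\<bar>bit_sum (\<lambda>n. 2 powr (real n * s) * e n) N / real N powr s\<bar> \<le> D / real N powr s + \<epsilon> / 2"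
    if N: "N > 0" for N
  proof -
    have "\<bar>bit_sum (\<lambda>n. 2 powr (real n * s) * e n) N\<bar> \<le> bit_sum (\<lambda>n. \<bar>2 powr (real n * s) * e n\<bar>) N"
      unfolding bit_sum_def by (rule sum_abs)
    also have "\<dots> \<le> bit_sum (\<lambda>n. d n + \<delta> * 2 powr (real n * s)) N"
    proof (rule bit_sum_mono)
      fix n
      show "\<bar>2 powr (real n * s) * e n\<bar> \<le> d n + \<delta> * 2 powr (real n * s)"
        using m[of n] \<delta> by (cases "n < m") (simp_all add: d_def abs_mult)
    qed
    also have "\<dots> = bit_sum d N + \<delta> * bit_sum (\<lambda>n. 2 powr (real n * s)) N"
      by (simp add: bit_sum_add bit_sum_cmult)
    also have "bit_sum d N \<le> D"
    proof -
      have "bit_sum d N = (\<Sum>n\<in>set_decode N \<inter> {..<m}. d n)"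
        unfolding bit_sum_def by (rule sum.mono_neutral_right) (auto simp: d_def)
      also have "\<dots> \<le> D" unfolding D_def using d by (intro sum_mono2) auto
      finally show ?thesis .
    qed
    also have "bit_sum (\<lambda>n. 2 powr (real n * s)) N \<le> C * real N powr s"
      using G_eta_bounded[OF assms(1) N] N by (simp add: G_eta C_def divide_le_eq)
    finally have "\<bar>bit_sum (\<lambda>n. 2 powr (real n * s) * e n) N\<bar> \<le> D + \<delta> * (C * real N powr s)"
      using \<delta> by (simp add: mult_left_mono)
    then have "\<bar>bit_sum (\<lambda>n. 2 powr (real n * s) * e n) N\<bar> / real N powr s
        \<le> (D + \<delta> * (C * real N powr s)) / real N powr s"
      by (rule divide_right_mono) simp
    also have "\<dots> = D / real N powr s + \<epsilon> / 2"
      using N C by (simp add: \<delta>_def add_divide_distrib)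
    finally show ?thesis by (simp add: abs_divide)
  qed
  have "(\<lambda>N. D / real N powr s) \<longlonglongrightarrow> 0" using assms(1) by real_asymp
  then obtain N0 where N0: "\<And>N. N \<ge> N0 \<Longrightarrow> \<bar>D / real N powr s\<bar> < \<epsilon> / 2"
    using LIMSEQ_D[of _ 0 "\<epsilon> / 2"] \<epsilon> by force
  show "\<exists>no. \<forall>N\<ge>no. norm (bit_sum (\<lambda>n. 2 powr (real n * s) * e n) N / real N powr s - 0) < \<epsilon>"
  proof (intro exI allI impI)
    fix N assume "N \<ge> max N0 1"
    then have "N > 0" "N \<ge> N0" by auto
    then show "norm (bit_sum (\<lambda>n. 2 powr (real n * s) * e n) N / real N powr s - 0) < \<epsilon>"
      unfolding real_norm_def diff_0_right
      using bound[of N] N0[of N] abs_ge_self[of "D / real N powr s"] by linarith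
  qed
qed

lemma tendsto_at_power_2:
  assumes "(\<lambda>p. f (2 * p)) \<longlonglongrightarrow> L"
  shows "(\<lambda>n. f (2 ^ n :: nat)) \<longlonglongrightarrow> L"
proof -
  have "filterlim (\<lambda>n. 2 ^ n :: nat) at_top at_top"
    by (rule filterlim_subseq) (simp add: strict_mono_def)
  from filterlim_compose[OF assms this] have "(\<lambda>n. f (2 ^ Suc n :: nat)) \<longlonglongrightarrow> L" by simp
  then show ?thesis by (rule LIMSEQ_imp_Suc)
qed

lemma strict_mono_repunit: "strict_mono (\<lambda>k. 2 ^ k - 1 :: nat)"
proof (rule strict_monoI_Suc)
  fix k
  have "(2::nat) ^ k < 2 ^ Suc k" "(1::nat) \<le> 2 ^ k" by simp_all
  then show "2 ^ k - 1 < (2 ^ Suc k - 1 :: nat)" by (rule diff_less_mono)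
qed

lemma INF_eq_repunit_limit:
  fixes h :: "nat \<Rightarrow> real"
  assumes "\<And>N. N > 0 \<Longrightarrow> c \<le> h N" "(\<lambda>k. h (2 ^ k - 1)) \<longlonglongrightarrow> c"
  shows "(INF N\<in>{1..}. ereal (h N)) = ereal c"
proof (rule antisym)
  show "ereal c \<le> (INF N\<in>{1..}. ereal (h N))" using assms(1) by (intro INF_greatest) auto
  have "(\<lambda>k. ereal (h (2 ^ k - 1))) \<longlonglongrightarrow> ereal c" using assms(2) by simp
  moreover have "(INF N\<in>{1..}. ereal (h N)) \<le> ereal (h (2 ^ k - 1))" if "k \<ge> 1" for k
    using one_less_power[of "2::nat" k] that by (intro INF_lower) auto
  ultimately show "(INF N\<in>{1..}. ereal (h N)) \<le> ereal c"
    by (meson LIMSEQ_le_const)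
qed

lemma SUP_eq_repunit_limit:
  fixes h :: "nat \<Rightarrow> real"
  assumes "\<And>N. N > 0 \<Longrightarrow> h N \<le> c" "(\<lambda>k. h (2 ^ k - 1)) \<longlonglongrightarrow> c"
  shows "(SUP N\<in>{1..}. ereal (h N)) = ereal c"
proof (rule antisym)
  show "(SUP N\<in>{1..}. ereal (h N)) \<le> ereal c" using assms(1) by (intro SUP_least) auto
  have "(\<lambda>k. ereal (h (2 ^ k - 1))) \<longlonglongrightarrow> ereal c" using assms(2) by simp
  moreover have "ereal (h (2 ^ k - 1)) \<le> (SUP N\<in>{1..}. ereal (h N))" if "k \<ge> 1" for k
    using one_less_power[of "2::nat" k] that by (intro SUP_upper) auto
  ultimately show "ereal c \<le> (SUP N\<in>{1..}. ereal (h N))"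
    by (meson LIMSEQ_le_const2)
qed

lemma liminf_eq_repunit_limit:
  fixes f :: "nat \<Rightarrow> ereal" and g e :: "nat \<Rightarrow> real"
  assumes f: "\<And>N. N > 0 \<Longrightarrow> f N = ereal (g N + e N)"
    and g: "\<And>N. N > 0 \<Longrightarrow> c \<le> g N" "(\<lambda>k. g (2 ^ k - 1)) \<longlonglongrightarrow> c" and e: "e \<longlonglongrightarrow> 0"
  shows "liminf f = ereal c"
proof (rule antisym)
  have ev: "\<forall>\<^sub>F N in sequentially. ereal (c + e N) \<le> f N"
    using eventually_gt_at_top[of 0] by eventually_elim (simp add: f g)
  have "(\<lambda>N. c + e N) \<longlonglongrightarrow> c + 0" by (intro tendsto_intros e)
  then have "liminf (\<lambda>N. ereal (c + e N)) = ereal c"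
    by (intro lim_imp_Liminf) auto
  then show "ereal c \<le> liminf f" using Liminf_mono[OF ev] by simp
  have "(\<lambda>k. g (2 ^ k - 1) + e (2 ^ k - 1)) \<longlonglongrightarrow> c + 0"
    using LIMSEQ_subseq_LIMSEQ[OF e strict_mono_repunit] by (intro tendsto_intros g) (simp add: comp_def)
  then have "(\<lambda>k. ereal (g (2 ^ k - 1) + e (2 ^ k - 1))) \<longlonglongrightarrow> ereal c" by simp
  then have "(\<lambda>k. f (2 ^ k - 1)) \<longlonglongrightarrow> ereal c"
  proof (rule Lim_transform_eventually)
    show "\<forall>\<^sub>F k in sequentially. ereal (g (2 ^ k - 1) + e (2 ^ k - 1)) = f (2 ^ k - 1)"
      using eventually_gt_at_top[of 0]
    proof eventually_elim
      case (elim k)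
      then have "2 ^ k - 1 > (0::nat)" using one_less_power[of "2::nat" k] by simp
      then show ?case by (simp only: f)
    qed
  qed
  then have "liminf (\<lambda>k. f (2 ^ k - 1)) = ereal c" by (intro lim_imp_Liminf) auto
  then show "liminf f \<le> ereal c"
    using liminf_subseq_mono[OF strict_mono_repunit, of f] by (simp add: comp_def)
qed

text \<open>
  Since \<open>mid_sum s m = m I + (2\<^sup>s - 1) c m\<^sup>s + o(m\<^sup>s)\<close>, summation over the digits gives
  \<open>F = (2\<^sup>s - 1) c G(\<eta>(N); s) + o(1)\<close>. The main term is at least \<open>c\<close> by the last assumption and tends to
  \<open>c\<close> along \<open>N = 2\<^sup>k - 1\<close>.
\<close>

lemma greedy_liminf_powr:
  assumes s: "s > 0" and greedy: "greedy_sequence s a"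
    and lim: "(\<lambda>p. (mid_sum s (2 * p) - real (2 * p) * I) / real (2 * p) powr s) \<longlonglongrightarrow> (2 powr s - 1) * c"
    and F: "\<And>N U. N > 0 \<Longrightarrow> 0 \<le> U \<Longrightarrow> potential a s N (a N) = ennreal U \<Longrightarrow>
      F a s N = ereal ((U - real N * I) / real N powr s)"
    and c: "\<And>N. N > 0 \<Longrightarrow> c \<le> (2 powr s - 1) * c * G (eta N) s"
  shows "liminf (F a s) = ereal c"
proof -
  define A where "A = (2 powr s - 1) * c"
  have s0: "2 powr s - 1 \<noteq> 0" using two_powr_gt_1[OF s] by linarith
  define e where "e = (\<lambda>n. (mid_sum s (2 ^ n) - real (2 ^ n) * I) / real (2 ^ n) powr s - A)"
  have "(\<lambda>n. (mid_sum s (2 ^ n) - real (2 ^ n) * I) / real (2 ^ n) powr s) \<longlonglongrightarrow> A"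
    unfolding A_def using lim by (rule tendsto_at_power_2)
  then have "e \<longlonglongrightarrow> 0" unfolding e_def by (simp add: LIM_zero_iff)
  then have err: "(\<lambda>N. bit_sum (\<lambda>n. 2 powr (real n * s) * e n) N / real N powr s) \<longlonglongrightarrow> 0"
    by (rule bit_sum_null[OF s])
  show ?thesis
  proof (rule liminf_eq_repunit_limit[OF _ _ _ err])
    show "(\<lambda>k. A * G (eta (2 ^ k - 1)) s) \<longlonglongrightarrow> c"
      using tendsto_mult[OF tendsto_const[of A] G_eta_repunit_tendsto[OF s]] s0 by (simp add: A_def)
    fix N :: nat assume N: "N > 0"
    show "c \<le> A * G (eta N) s" unfolding A_def by (rule c[OF N])
    define U where "U = bit_sum (\<lambda>n. mid_sum s (2 ^ n)) N"
    have "mid_sum s (2 ^ n) = I * 2 ^ n + A * 2 powr (real n * s) + 2 powr (real n * s) * e n" for n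
      by (simp add: e_def power_2_powr field_simps)
    then have "U = I * real N + A * bit_sum (\<lambda>n. 2 powr (real n * s)) N + bit_sum (\<lambda>n. 2 powr (real n * s) * e n) N"
      by (simp add: U_def bit_sum_add bit_sum_cmult bit_sum_power_2)
    moreover have "F a s N = ereal ((U - real N * I) / real N powr s)"
      unfolding U_def
      by (intro F N bit_sum_nonneg mid_sum_nonneg greedy_potential[OF s greedy_sequence_imp_upto[OF greedy]])
    ultimately show "F a s N = ereal (A * G (eta N) s + bit_sum (\<lambda>n. 2 powr (real n * s) * e n) N / real N powr s)"
      using N by (simp add: G_eta add_divide_distrib)
  qed
qed

text \<open>
  Here the main term of a digit \<open>m = 2\<^sup>n\<close> is \<open>m ln m / \<pi>\<close>. The sum of these terms, compared with
  \<open>N ln N / \<pi>\<close>, leaves \<open>\<Lambda>(\<eta>(N)) / \<pi>\<close>, and the infimum \<open>- 2 ln 2\<close> of \<open>\<Lambda>\<close> cancels the term \<open>2 ln 2\<close> in the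
  expansion of the midpoint sum.
\<close>

lemma greedy_liminf_1:
  assumes greedy: "greedy_sequence 1 a"
  shows "liminf (F a 1) = ereal (1 / pi * (euler_mascheroni + ln (2 / pi)))"
proof -
  define c where "c = 1 / pi * (euler_mascheroni + ln (2 / pi))"
  define L where "L = 1 / pi * (euler_mascheroni + ln (2 / pi) + 2 * ln 2)"
  have L: "L = c + 2 * ln 2 / pi" by (simp add: L_def c_def field_simps)
  define e where "e = (\<lambda>n. mid_sum 1 (2 ^ n) / real (2 ^ n) - ln (real (2 ^ n)) / pi - L)"
  have "(\<lambda>n. mid_sum 1 (2 ^ n) / real (2 ^ n) - ln (real (2 ^ n)) / pi) \<longlonglongrightarrow> L"
    unfolding L_def by (rule tendsto_at_power_2[OF mid_sum_limit_1])
  then have "e \<longlonglongrightarrow> 0" unfolding e_def by (simp add: LIM_zero_iff)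
  then have err: "(\<lambda>N. bit_sum (\<lambda>n. 2 powr (real n * 1) * e n) N / real N powr 1) \<longlonglongrightarrow> 0"
    by (intro bit_sum_null) auto
  have "liminf (F a 1) = ereal c"
  proof (rule liminf_eq_repunit_limit[OF _ _ _ err])
    have "(\<lambda>k. Lambda (eta (2 ^ k - 1)) / pi + L) \<longlonglongrightarrow> - 2 * ln 2 / pi + L"
      by (intro tendsto_intros Lambda_eta_repunit_tendsto) auto
    then show "(\<lambda>k. Lambda (eta (2 ^ k - 1)) / pi + L) \<longlonglongrightarrow> c" by (simp add: L)
    fix N :: nat assume N: "N > 0"
    have "- 2 * ln 2 / pi \<le> Lambda (eta N) / pi"
      using Lambda_eta_ge[OF N] by (intro divide_right_mono) auto
    then show "c \<le> Lambda (eta N) / pi + L" by (simp add: L)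
    define U where "U = bit_sum (\<lambda>n. mid_sum 1 (2 ^ n)) N"
    have "mid_sum 1 (2 ^ n) = 1 / pi * (2 ^ n * (real n * ln 2)) + L * 2 ^ n + 2 powr (real n * 1) * e n" for n
      by (simp add: e_def powr_realpow ln_realpow field_simps)
    then have "U = 1 / pi * bit_sum (\<lambda>n. 2 ^ n * (real n * ln 2)) N + L * real N
        + bit_sum (\<lambda>n. 2 powr (real n * 1) * e n) N"
      unfolding U_def by (simp only: bit_sum_add bit_sum_cmult bit_sum_power_2)
    moreover have "potential a 1 N (a N) = ennreal U" "0 \<le> U"
      unfolding U_def
      by (auto intro!: bit_sum_nonneg mid_sum_nonneg greedy_potential greedy_sequence_imp_upto[OF greedy])
    ultimately show "F a 1 N = ereal (Lambda (eta N) / pi + L + bit_sum (\<lambda>n. 2 powr (real n * 1) * e n) N / real N powr 1)"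
      using N by (simp add: F_def Lambda_eta field_simps)
  qed
  then show ?thesis by (simp add: c_def)
qed

text \<open>
  The coefficient \<open>c\<close> has the sign of \<open>zeta s \<le> 0\<close>, so the lower limit comes from the supremum of \<open>G\<close>.
\<close>

lemma greedy_liminf_less_1:
  assumes "0 < s" "s < 1" "greedy_sequence s a"
  shows "liminf (F a s) = ereal (2 * Re (zeta (complex_of_real s)) / (2 * pi) powr s)"
proof (rule greedy_liminf_powr[OF assms(1,3) mid_sum_limit_less_1[OF assms(1,2)]])
  let ?c = "2 * Re (zeta (complex_of_real s)) / (2 * pi) powr s"
  fix N :: nat assume N: "N > 0"
  show "F a s N = ereal ((U - real N * circle_kernel_mean s) / real N powr s)"
    if "0 \<le> U" "potential a s N (a N) = ennreal U" for U
    using that N assms circle_kernel_mean_nonneg[of s] by (simp add: F_def circle_energy_eq)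
  have gt: "0 < 2 powr s - 1" using two_powr_gt_1[OF assms(1)] by linarith
  have "?c \<le> 0"
    using zeta_real_less_1_nonpos[OF assms(1,2)] by (intro divide_nonpos_nonneg) auto
  then have "(2 powr s - 1) * ?c \<le> 0"
    by (rule mult_nonneg_nonpos[OF less_imp_le[OF gt]])
  then have "(2 powr s - 1) * ?c * (1 / (2 powr s - 1)) \<le> (2 powr s - 1) * ?c * G (eta N) s"
    using assms N by (intro mult_left_mono_neg G_eta_le) auto
  with gt assms show "?c \<le> (2 powr s - 1) * ?c * G (eta N) s" by simp
qed

text \<open>
  Now \<open>zeta s \<ge> 0\<close>, and the lower limit comes from the infimum of \<open>G\<close>.
\<close>

lemma greedy_liminf_gt_1:
  assumes "s > 1" "greedy_sequence s a"
  shows "liminf (F a s) = ereal (2 * Re (zeta (complex_of_real s)) / (2 * pi) powr s)"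
proof (rule greedy_liminf_powr[of s a 0])
  let ?c = "2 * Re (zeta (complex_of_real s)) / (2 * pi) powr s"
  show "(\<lambda>p. (mid_sum s (2 * p) - real (2 * p) * 0) / real (2 * p) powr s) \<longlonglongrightarrow> (2 powr s - 1) * ?c"
    using mid_sum_limit_gt_1[OF assms(1)] by simp
  fix N :: nat assume N: "N > 0"
  show "F a s N = ereal ((U - real N * 0) / real N powr s)"
    if "0 \<le> U" "potential a s N (a N) = ennreal U" for U
    using that N assms by (simp add: F_def)
  have gt: "0 < 2 powr s - 1" using two_powr_gt_1[of s] assms by linarith
  have "0 \<le> Re (zeta (complex_of_real s))"
    using sums_le[OF _ sums_zero zeta_real_gt_1_sums[OF assms(1)]] by simp
  then have "0 \<le> ?c" by (intro divide_nonneg_nonneg) auto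
  then have "0 \<le> (2 powr s - 1) * ?c"
    by (rule mult_nonneg_nonneg[OF less_imp_le[OF gt]])
  then have "(2 powr s - 1) * ?c * (1 / (2 powr s - 1)) \<le> (2 powr s - 1) * ?c * G (eta N) s"
    using assms N by (intro mult_left_mono G_eta_ge) auto
  with gt assms show "?c \<le> (2 powr s - 1) * ?c * G (eta N) s" by simp
qed (use assms in auto)

theorem theorem1p1:
  shows "(\<forall>s::real. 0 < s \<and> s < 1 \<longrightarrow>
            (SUP N\<in>{1..}. ereal (G (eta N) s)) = ereal (1 / (2 powr s - 1))) \<and>
         (\<forall>s::real. s > 1 \<longrightarrow>
            (INF N\<in>{1..}. ereal (G (eta N) s)) = ereal (1 / (2 powr s - 1))) \<and>
         (INF N\<in>{1..}. ereal (Lambda (eta N))) = ereal (- 2 * ln 2) \<and>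
         (\<forall>(s::real) a. s > 0 \<longrightarrow> greedy_sequence s a \<longrightarrow>
            liminf (F a s) =
              (if s = 1 then ereal (1 / pi * (euler_mascheroni + ln (2 / pi)))
               else ereal (2 * Re (zeta (complex_of_real s)) / (2 * pi) powr s)))"
proof (intro conjI allI impI)
  fix s :: real assume "0 < s \<and> s < 1"
  then show "(SUP N\<in>{1..}. ereal (G (eta N) s)) = ereal (1 / (2 powr s - 1))"
    by (intro SUP_eq_repunit_limit G_eta_le G_eta_repunit_tendsto) auto
next
  fix s :: real assume "s > 1"
  then show "(INF N\<in>{1..}. ereal (G (eta N) s)) = ereal (1 / (2 powr s - 1))"
    by (intro INF_eq_repunit_limit G_eta_ge G_eta_repunit_tendsto) auto
next
  show "(INF N\<in>{1..}. ereal (Lambda (eta N))) = ereal (- 2 * ln 2)"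
    by (intro INF_eq_repunit_limit Lambda_eta_ge Lambda_eta_repunit_tendsto)
next
  fix s :: real and a assume "s > 0" "greedy_sequence s a"
  then show "liminf (F a s) =
      (if s = 1 then ereal (1 / pi * (euler_mascheroni + ln (2 / pi)))
       else ereal (2 * Re (zeta (complex_of_real s)) / (2 * pi) powr s))"
    using greedy_liminf_1[of a] greedy_liminf_less_1[of s a] greedy_liminf_gt_1[of s a]
    by (cases s "1::real" rule: linorder_cases) auto
qed

end
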